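(* Let $\boldsymbol\omega=(\omega_1,\dots,\omega_n)$ be non-random weights with $\omega_i>0$ and $\sum_{i=1}^n\omega_i=n$, and let $F\in\mathscr{R}^*_{-1}$ (tail index $\gamma=1$). Consider p-values $P_1,\dots,P_n$ (random variables in $[0,1]$), with set of dominating signals $I_{\mathbf P}$, such that: (i) each $P_i$ is continuously distributed; (ii) the vector $(1-P_1,\dots,1-P_n)$ has an MRV copula; (iii) for any distinct $i,j\in I_{\mathbf P}$, $\lim_{t\downarrow0}\mathbb{P}(P_i<t)/\mathbb{P}(P_j<t)$ exists in $(0,\infty)$; and for at least one $i\in I_{\mathbf P}$ there exists $F_0\in\mathscr{R}_{-1}$ such that the distribution of $Q_{F_0}(1-P_i)$ belongs to $\mathscr{R}_{-1}$. Let $C^*$ denote the limiting copula of $(1-P_1,\dots,1-P_n)$. Then, with the marginal distributions of $P_1,\dots,P_n$ held fixed, the asymptotic power ratio between the weighted combination test with $\gamma=1$ and the weighted Bonferroni test, $$\tilde r(C^* )=\lim_{\alpha\downarrow0}\frac{\mathbb{P}\left(P_{\mathrm{comb}}^{F,\boldsymbol\omega}\le\alpha\right)}{\mathbb{P}\left(P_{\mathrm{bon}}^{\boldsymbol\omega}\le\alpha\right)},$$ is non-decreasing in $C^*$ under the pointwise order. That is, for two such p-value vectors with the same marginals and with limiting copulas $C_1^*$ and $C_2^*$, if $C_1^*\preceq_{\mathrm{pw}}C_2^*$ then $\tilde r(C_1^* )\le\tilde r(C_2^* )$.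
   Context: The number $n$ of p-values is fixed; $\mathbb{P}$ is probability under the true configuration of hypotheses. For a CDF $F$, $\overline F=1-F$ and $Q_F(t)=\inf\{x\in\mathbb{R}:F(x)\ge t\}$ for $t\in(0,1)$; when the support of $F$ is $[c,\infty)$ set $Q_F(0)=c$. For $\gamma>0$, $\mathscr{R}_{-\gamma}$ is the class of CDFs $F$ with $\lim_{x\to\infty}\overline F(xy)/\overline F(x)=y^{-\gamma}$ for all $y>0$. $\mathscr{R}^*_{-\gamma}$ is the class of $F\in\mathscr{R}_{-\gamma}$ that are continuous and strictly increasing on their support, with support $[c,\infty)$ for some $c\in\mathbb{R}$. Weighted heavy-tailed combination test: for $F\in\mathscr{R}^*_{-\gamma}$, with $x^+=\max(0,x)$, $$\bar X_{n,\boldsymbol\omega}=\frac1n\sum_{i=1}^n Q_F\left((1-P_i/\omega_i)^+\right),\qquad P_{\mathrm{comb}}^{F,\boldsymbol\omega}=\min\left(1,\,n^{1-\gamma}\,\overline F(\bar X_{n,\boldsymbol\omega})\right).$$ Weighted Bonferroni test: $P_{\mathrm{bon}}^{\boldsymbol\omega}=\min\left(1,\,n\min_{i=1,\dots,n}P_i/\omega_i\right)$. Dominating signals: write $P_i\succ P_j$ if $\lim_{t\downarrow0}\mathbb{P}(P_i<t)/\mathbb{P}(P_j<t)=0$. Then $I_{\mathbf P}=\{i\in\{1,\dots,n\}:\text{there is no } j\in\{1,\dots,n\}\text{ with }P_i\succ P_j\}$. MRV copula: for an $n$-dimensional copula $C$ let $D(u_1,\dots,u_n)=1-C(1-u_1,\dots,1-u_n)$.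 $C$ is an MRV copula if for some (real-valued) function $\ell$, $\lim_{s\downarrow0}s^{-1}D(sv_1,\dots,sv_n)=\ell(v_1,\dots,v_n)$ for all $v_1,\dots,v_n\ge0$. Equivalently, there is a copula $C^*$ (the limiting copula of $C$, and of any random vector with copula $C$) with $\lim_{t\to\infty}C(u_1^{1/t},\dots,u_n^{1/t})^t=C^*(u_1,\dots,u_n)$ for all $u\in[0,1]^n$. Pointwise order: $C_1\preceq_{\mathrm{pw}}C_2$ means $C_1(u)\le C_2(u)$ for all $u\in[0,1]^n$. *)

theory Defs
  imports "HOL-Probability.Probability"
begin

section \<open>Distribution functions, quantiles and regular variation\<close>

definition is_cdf :: "(real \<Rightarrow> real) \<Rightarrow> bool" where
  "is_cdf F \<longleftrightarrow> (\<exists>N. real_distribution N \<and> F = cdf N)"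

definition tail :: "(real \<Rightarrow> real) \<Rightarrow> real \<Rightarrow> real" where
  "tail F x = 1 - F x"

definition cdf_support :: "(real \<Rightarrow> real) \<Rightarrow> real set" where
  "cdf_support F = {x. \<forall>e>0. F (x - e) < F (x + e)}"

text \<open>
  The clause for \<open>t = 0\<close> yields \<open>c\<close> when the support is \<open>{c..}\<close>.  Outside \<open>0 \<le> t < 1\<close> the value is
  irrelevant: \<open>t = 1\<close> arises only from a p-value equal to \<open>0\<close>, a null event for continuous p-values.
\<close>
definition quantile :: "(real \<Rightarrow> real) \<Rightarrow> real \<Rightarrow> real" where
  "quantile F t = (if t = 0 then Inf (cdf_support F) else Inf {x. F x \<ge> t})"

text \<open>
  If \<open>tail F\<close> vanished eventually, the quotient would be eventually \<open>0 / 0 = 0\<close>, which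
  is not \<open>y powr (- \<gamma>)\<close>; so such \<open>F\<close> are excluded.
\<close>
definition RV :: "real \<Rightarrow> (real \<Rightarrow> real) set" where
  "RV \<gamma> = {F. is_cdf F \<and>
     (\<forall>y>0. ((\<lambda>x. tail F (x * y) / tail F x) \<longlongrightarrow> y powr (- \<gamma>)) at_top)}"

definition RV_star :: "real \<Rightarrow> (real \<Rightarrow> real) set" where
  "RV_star \<gamma> = {F \<in> RV \<gamma>. (\<exists>c. cdf_support F = {c..}) \<and>
     continuous_on (cdf_support F) F \<and> strict_mono_on (cdf_support F) F}"

section \<open>Copulas\<close>

definition unit_cube :: "(real ^ 'n) set" where
  "unit_cube = {u. \<forall>i. 0 \<le> u $ i \<and> u $ i \<le> 1}"

text \<open>
  A copula is the joint distribution function, restricted to the unit cube, of a random vector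
  with standard uniform margins.  Values outside the cube are unconstrained and never used.
\<close>
definition is_copula :: "(real ^ 'n \<Rightarrow> real) \<Rightarrow> bool" where
  "is_copula C \<longleftrightarrow> (\<exists>\<mu> :: (real ^ 'n) measure. prob_space \<mu> \<and> sets \<mu> = sets borel \<and>
     (\<forall>i. distr \<mu> borel (\<lambda>x. x $ i) = uniform_measure lborel {0..1}) \<and>
     (\<forall>u\<in>unit_cube. C u = measure \<mu> {x. \<forall>i. x $ i \<le> u $ i}))"

definition copula_of :: "'a measure \<Rightarrow> ('n::finite \<Rightarrow> 'a \<Rightarrow> real) \<Rightarrow> (real ^ 'n \<Rightarrow> real) \<Rightarrow> bool" where
  "copula_of M X C \<longleftrightarrow> is_copula C \<and>
     (\<forall>x :: real ^ 'n. measure M {\<omega> \<in> space M. \<forall>i. X i \<omega> \<le> x $ i} =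
        C (\<chi> i. cdf (distr M borel (X i)) (x $ i)))"

definition copula_D :: "(real ^ 'n \<Rightarrow> real) \<Rightarrow> real ^ 'n \<Rightarrow> real" where
  "copula_D C u = 1 - C (\<chi> i. 1 - u $ i)"

definition MRV_copula :: "(real ^ 'n \<Rightarrow> real) \<Rightarrow> bool" where
  "MRV_copula C \<longleftrightarrow> is_copula C \<and> (\<exists>l :: real ^ 'n \<Rightarrow> real. \<forall>v. (\<forall>i. 0 \<le> v $ i) \<longrightarrow>
     ((\<lambda>s. copula_D C (s *\<^sub>R v) / s) \<longlongrightarrow> l v) (at_right 0))"

definition limiting_copula :: "(real ^ 'n \<Rightarrow> real) \<Rightarrow> (real ^ 'n \<Rightarrow> real) \<Rightarrow> bool" where
  "limiting_copula C C' \<longleftrightarrow> is_copula C' \<and>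
     (\<forall>u\<in>unit_cube. ((\<lambda>t. C (\<chi> i. u $ i powr (1 / t)) powr t) \<longlongrightarrow> C' u) at_top)"

definition has_MRV_copula :: "'a measure \<Rightarrow> ('n::finite \<Rightarrow> 'a \<Rightarrow> real) \<Rightarrow> bool" where
  "has_MRV_copula M X \<longleftrightarrow> (\<exists>C. copula_of M X C \<and> MRV_copula C)"

definition limiting_copula_of ::
    "'a measure \<Rightarrow> ('n::finite \<Rightarrow> 'a \<Rightarrow> real) \<Rightarrow> (real ^ 'n \<Rightarrow> real) \<Rightarrow> bool" where
  "limiting_copula_of M X C' \<longleftrightarrow> (\<exists>C. copula_of M X C \<and> limiting_copula C C')"

definition pw_le :: "(real ^ 'n \<Rightarrow> real) \<Rightarrow> (real ^ 'n \<Rightarrow> real) \<Rightarrow> bool" (infix "\<preceq>pw" 50) where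
  "C1 \<preceq>pw C2 \<longleftrightarrow> (\<forall>u\<in>unit_cube. C1 u \<le> C2 u)"

section \<open>P-values and combination tests\<close>

definition pvalues :: "'a measure \<Rightarrow> ('n::finite \<Rightarrow> 'a \<Rightarrow> real) \<Rightarrow> bool" where
  "pvalues M P \<longleftrightarrow> prob_space M \<and>
     (\<forall>i. P i \<in> borel_measurable M \<and> (\<forall>\<omega>\<in>space M. 0 \<le> P i \<omega> \<and> P i \<omega> \<le> 1))"

definition continuously_distributed :: "'a measure \<Rightarrow> ('a \<Rightarrow> real) \<Rightarrow> bool" where
  "continuously_distributed M X \<longleftrightarrow> continuous_on UNIV (cdf (distr M borel X))"

definition prob_below :: "'a measure \<Rightarrow> ('a \<Rightarrow> real) \<Rightarrow> real \<Rightarrow> real" where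
  "prob_below M X t = measure M {\<omega> \<in> space M. X \<omega> < t}"

text \<open>
  \<open>dominated M X Y\<close> is the relation \<open>X \<succ> Y\<close>.  The first conjunct makes the quotient
  meaningful near \<open>0\<close>; without it, \<open>x / 0 = 0\<close> would make every \<open>X\<close> dominated by a \<open>Y\<close> that
  stays away from \<open>0\<close>.
\<close>
definition dominated :: "'a measure \<Rightarrow> ('a \<Rightarrow> real) \<Rightarrow> ('a \<Rightarrow> real) \<Rightarrow> bool" where
  "dominated M X Y \<longleftrightarrow> (\<forall>\<^sub>F t in at_right 0. prob_below M Y t > 0) \<and>
     ((\<lambda>t. prob_below M X t / prob_below M Y t) \<longlongrightarrow> 0) (at_right 0)"

definition dominating_signals :: "'a measure \<Rightarrow> ('n \<Rightarrow> 'a \<Rightarrow> real) \<Rightarrow> 'n set" where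
  "dominating_signals M P = {i. \<not> (\<exists>j. dominated M (P i) (P j))}"

definition comparable_signals :: "'a measure \<Rightarrow> ('n \<Rightarrow> 'a \<Rightarrow> real) \<Rightarrow> bool" where
  "comparable_signals M P \<longleftrightarrow>
     (\<forall>i\<in>dominating_signals M P. \<forall>j\<in>dominating_signals M P. i \<noteq> j \<longrightarrow>
        (\<exists>L>0. ((\<lambda>t. prob_below M (P i) t / prob_below M (P j) t) \<longlongrightarrow> L) (at_right 0)))"

definition regular_signal :: "'a measure \<Rightarrow> ('n \<Rightarrow> 'a \<Rightarrow> real) \<Rightarrow> bool" where
  "regular_signal M P \<longleftrightarrow>
     (\<exists>i\<in>dominating_signals M P. \<exists>F0\<in>RV 1.
        cdf (distr M borel (\<lambda>\<omega>. quantile F0 (1 - P i \<omega>))) \<in> RV 1)"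

definition weighted_mean_quantile ::
    "(real \<Rightarrow> real) \<Rightarrow> ('n::finite \<Rightarrow> real) \<Rightarrow> ('n \<Rightarrow> real) \<Rightarrow> real" where
  "weighted_mean_quantile F w p =
     (1 / real CARD('n)) * (\<Sum>i\<in>UNIV. quantile F (max 0 (1 - p i / w i)))"

definition P_comb ::
    "real \<Rightarrow> (real \<Rightarrow> real) \<Rightarrow> ('n::finite \<Rightarrow> real) \<Rightarrow> ('n \<Rightarrow> real) \<Rightarrow> real" where
  "P_comb \<gamma> F w p =
     min 1 (real CARD('n) powr (1 - \<gamma>) * tail F (weighted_mean_quantile F w p))"

definition P_bon :: "('n::finite \<Rightarrow> real) \<Rightarrow> ('n \<Rightarrow> real) \<Rightarrow> real" where
  "P_bon w p = min 1 (real CARD('n) * (MIN i. p i / w i))"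

definition power_ratio ::
    "'a measure \<Rightarrow> real \<Rightarrow> (real \<Rightarrow> real) \<Rightarrow> ('n::finite \<Rightarrow> real) \<Rightarrow> ('n \<Rightarrow> 'a \<Rightarrow> real)
      \<Rightarrow> real \<Rightarrow> real" where
  "power_ratio M \<gamma> F w P \<alpha> =
     measure M {\<omega> \<in> space M. P_comb \<gamma> F w (\<lambda>i. P i \<omega>) \<le> \<alpha>} /
     measure M {\<omega> \<in> space M. P_bon w (\<lambda>i. P i \<omega>) \<le> \<alpha>}"

end

theory Submission
  imports Defs "HOL-Real_Asymp.Real_Asymp"
begin

text \<open>
  Let \<open>h\<close> be the distribution function, near \<open>0\<close>, of the dominating signal whose quantile transform
  is regularly varying.  That hypothesis makes \<open>h\<close> regularly varying at \<open>0\<close> with index \<open>1\<close>, and by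
  comparability (or domination), for every \<open>i\<close> the quotient \<open>prob_below M (P i) t / h t\<close> tends to some \<open>L i \<ge> 0\<close> as
  \<open>t\<close> decreases to \<open>0\<close> (lemma \<open>signal_strengths\<close>).  The constants \<open>L i\<close> depend on the marginals only.

  \<^item> Bonferroni.  The rejection event is the union of the events \<open>P i \<le> \<alpha> * w i / n\<close>.  Its probability is
    the copula functional \<open>copula_D\<close> at the marginal probabilities, so it is asymptotic to \<open>h \<alpha>\<close> times
    \<open>l (\<chi> i. L i * w i / n)\<close>, where \<open>l\<close> is the limit of \<open>copula_D C (s *\<^sub>R v) / s\<close>
    (lemma \<open>bonferroni_power\<close>).

  \<^item> Combination test.  The rejection event says that the sum of the variables
    \<open>X i = quantile F (max 0 (1 - P i / w i))\<close> is at least \<open>n\<close> times the quantile of \<open>F\<close> at \<open>1 - \<alpha>\<close>.  The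
    \<open>X i\<close> have multivariate regularly varying tails of index \<open>1\<close>, and for this index the tail of a
    sum is asymptotic to the sum of the marginal tails, whatever the dependence: the homogeneous
    limit measure has density \<open>1 / r\<^sup>2\<close> along rays, so the mass of
    \<open>{z. 1 \<le> (\<Sum>i. z i)}\<close> is linear in the angular coordinates.  Hence the power is asymptotic to
    \<open>h \<alpha>\<close> times \<open>(\<Sum>i. L i * w i) / n\<close>, which does not involve the copula
    (lemmas \<open>sum_tail_limit\<close> and \<open>combination_power\<close>).

  The asymptotic power ratio is therefore \<open>((\<Sum>i. L i * w i) / n) / l (\<chi> i. L i * w i / n)\<close>.  The limiting
  copula \<open>C'\<close> determines \<open>l\<close> by \<open>C' (\<chi> i. exp (- v $ i)) = exp (- l v)\<close>
  (lemma \<open>limiting_copula_eq_exp\<close>), so a pointwise larger limiting copula has a smaller \<open>l\<close> and a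
  larger ratio.

  The statement on sums is proved without constructing the limit measure.  A grid of cells, whose
  probabilities converge because those of unions of half-spaces do, gives the tail of the sum up to
  a factor \<open>1 - e\<close>.  The constant is then identified by counting how many of the levels
  \<open>x, 2 x, ..., K x\<close> are reached: the counts for the sum and for the summands agree up to an error
  whose scaled expectation stays bounded in \<open>K\<close>, while the main terms grow like the harmonic numbers.
\<close>

section \<open>Tails of sums of index one\<close>

text \<open>
  If the scaled probabilities of all unions \<open>\<exists>i. x * a i \<le> X i\<close> converge, then so do those of boxes
  that are bounded below in at least one coordinate.  The induction adds one lower bound at a time,
  as a difference of two probabilities; without any lower bound only \<open>1 - Q {} b x\<close> is of order \<open>H x\<close>.
\<close>
lemma cell_prob_convergent:
  fixes X :: "'n::finite \<Rightarrow> 'a \<Rightarrow> real" and H :: "real \<Rightarrow> real"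
  assumes "prob_space M" and X[measurable]: "\<And>i. X i \<in> borel_measurable M"
    and joint: "\<And>a. (\<And>i. a i > 0) \<Longrightarrow>
      \<exists>l. ((\<lambda>x. measure M {\<omega>\<in>space M. \<exists>i. X i \<omega> \<ge> x * a i} / H x) \<longlongrightarrow> l) at_top"
    and ab: "\<And>i. i \<in> T \<Longrightarrow> 0 < a i \<and> a i \<le> b i" and b: "\<And>i. 0 < b i" and T: "T \<noteq> {}"
  shows "\<exists>l. ((\<lambda>x. measure M {\<omega>\<in>space M. (\<forall>i. X i \<omega> < x * b i) \<and> (\<forall>i\<in>T. x * a i \<le> X i \<omega>)} / H x)
      \<longlongrightarrow> l) at_top"
proof -
  interpret prob_space M by fact
  define Q where "Q T b x = measure M {\<omega>\<in>space M. (\<forall>i. X i \<omega> < x * b i) \<and> (\<forall>i\<in>T. x * a i \<le> X i \<omega>)}"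
    for T b and x :: real
  have step: "Q (insert t T) b x = Q T b x - Q T (b(t := a t)) x"
    if "t \<notin> T" "a t \<le> b t" "x > 0" for t T b x
  proof -
    have lt: "X t \<omega> < x * b t" if "X t \<omega> < x * a t" for \<omega>
      using that mult_left_mono[OF \<open>a t \<le> b t\<close>, of x] \<open>x > 0\<close> by linarith
    have upd: "(\<forall>i. X i \<omega> < x * (b(t := a t)) i) \<longleftrightarrow> (\<forall>i. X i \<omega> < x * b i) \<and> X t \<omega> < x * a t" for \<omega>
      using lt[of \<omega>] by auto
    have "{\<omega>\<in>space M. (\<forall>i. X i \<omega> < x * b i) \<and> (\<forall>i\<in>insert t T. x * a i \<le> X i \<omega>)}
      = {\<omega>\<in>space M. (\<forall>i. X i \<omega> < x * b i) \<and> (\<forall>i\<in>T. x * a i \<le> X i \<omega>)}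
        - {\<omega>\<in>space M. (\<forall>i. X i \<omega> < x * (b(t := a t)) i) \<and> (\<forall>i\<in>T. x * a i \<le> X i \<omega>)}"
      unfolding upd by (auto simp flip: not_le)
    moreover have "{\<omega>\<in>space M. (\<forall>i. X i \<omega> < x * (b(t := a t)) i) \<and> (\<forall>i\<in>T. x * a i \<le> X i \<omega>)}
      \<subseteq> {\<omega>\<in>space M. (\<forall>i. X i \<omega> < x * b i) \<and> (\<forall>i\<in>T. x * a i \<le> X i \<omega>)}"
      unfolding upd by auto
    ultimately show ?thesis
      unfolding Q_def by (simp only:) (rule finite_measure_Diff, measurable)
  qed
  have base: "\<exists>l. ((\<lambda>x. (1 - Q {} b x) / H x) \<longlongrightarrow> l) at_top" if "\<forall>i. 0 < b i" for b
  proof -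
    have "1 - Q {} b x = measure M {\<omega>\<in>space M. \<exists>i. X i \<omega> \<ge> x * b i}" for x
    proof -
      have "{\<omega>\<in>space M. \<exists>i. X i \<omega> \<ge> x * b i} = space M - {\<omega>\<in>space M. (\<forall>i. X i \<omega> < x * b i)}"
        by (auto simp flip: not_le)
      then show ?thesis unfolding Q_def by (simp add: prob_compl)
    qed
    then show ?thesis using joint[OF that[rule_format]] by simp
  qed
  have "finite T" by simp
  then have "\<forall>b. (\<forall>i. 0 < b i) \<longrightarrow> (\<forall>i\<in>T. 0 < a i \<and> a i \<le> b i) \<longrightarrow> (\<exists>l. ((\<lambda>x. Q T b x / H x) \<longlongrightarrow> l) at_top)"
    using T
  proof (induction T rule: finite_ne_induct)
    case (singleton t)
    show ?case
    proof (intro allI impI)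
      fix b :: "'n \<Rightarrow> real" assume b: "\<forall>i. 0 < b i" and a: "\<forall>i\<in>{t}. 0 < a i \<and> a i \<le> b i"
      obtain l1 where l1: "((\<lambda>x. (1 - Q {} b x) / H x) \<longlongrightarrow> l1) at_top" using base b by blast
      have pos: "\<forall>i. 0 < (b(t := a t)) i" using a b by simp
      obtain l2 where l2: "((\<lambda>x. (1 - Q {} (b(t := a t)) x) / H x) \<longlongrightarrow> l2) at_top"
        using base[of "b(t := a t)"] pos by blast
      have "((\<lambda>x. Q {t} b x / H x) \<longlongrightarrow> l2 - l1) at_top"
      proof (rule Lim_transform_eventually[OF tendsto_diff[OF l2 l1]])
        show "\<forall>\<^sub>F x in at_top. (1 - Q {} (b(t := a t)) x) / H x - (1 - Q {} b x) / H x = Q {t} b x / H x"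
          using eventually_gt_at_top[of 0]
          by eventually_elim (use step[of t "{}" b] a in \<open>simp add: diff_divide_distrib\<close>)
      qed
      then show "\<exists>l. ((\<lambda>x. Q {t} b x / H x) \<longlongrightarrow> l) at_top" by blast
    qed
  next
    case (insert t T)
    show ?case
    proof (intro allI impI)
      fix b :: "'n \<Rightarrow> real" assume b: "\<forall>i. 0 < b i" and a: "\<forall>i\<in>insert t T. 0 < a i \<and> a i \<le> b i"
      have le: "0 < a i \<and> a i \<le> (b(t := a t)) i" if "i \<in> T" for i
        using a insert.hyps that by auto
      obtain l1 where l1: "((\<lambda>x. Q T b x / H x) \<longlongrightarrow> l1) at_top" using insert.IH b a by blast
      have pos: "\<forall>i. 0 < (b(t := a t)) i" using a b by simp
      obtain l2 where l2: "((\<lambda>x. Q T (b(t := a t)) x / H x) \<longlongrightarrow> l2) at_top"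
        using insert.IH[rule_format, of "b(t := a t)"] pos le by blast
      have "((\<lambda>x. Q (insert t T) b x / H x) \<longlongrightarrow> l1 - l2) at_top"
      proof (rule Lim_transform_eventually[OF tendsto_diff[OF l1 l2]])
        show "\<forall>\<^sub>F x in at_top. Q T b x / H x - Q T (b(t := a t)) x / H x = Q (insert t T) b x / H x"
          using eventually_gt_at_top[of 0]
          by eventually_elim (use step[of t T b] a insert.hyps in \<open>simp add: diff_divide_distrib\<close>)
      qed
      then show "\<exists>l. ((\<lambda>x. Q (insert t T) b x / H x) \<longlongrightarrow> l) at_top" by blast
    qed
  qed
  from this[rule_format, OF b] ab show ?thesis unfolding Q_def by simp
qed

text \<open>
  The function \<open>\<phi>\<close> is the scaled probability of a finite union of grid cells and its complement,
  squeezed between the events that the sum exceeds \<open>x\<close> and \<open>(1 - e) * x\<close>.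
\<close>
lemma sum_tail_grid_approximation:
  fixes X :: "'n::finite \<Rightarrow> 'a \<Rightarrow> real" and H :: "real \<Rightarrow> real"
  assumes "prob_space M" and X[measurable]: "\<And>i. X i \<in> borel_measurable M"
    and lower: "\<And>i. AE \<omega> in M. c \<le> X i \<omega>"
    and Hpos: "\<forall>\<^sub>F x in at_top. H x > 0"
    and joint: "\<And>a. (\<And>i. a i > 0) \<Longrightarrow>
      \<exists>l. ((\<lambda>x. measure M {\<omega>\<in>space M. \<exists>i. X i \<omega> \<ge> x * a i} / H x) \<longlongrightarrow> l) at_top"
    and e: "0 < e" "e < 1"
  shows "\<exists>\<phi> \<beta>. (\<phi> \<longlongrightarrow> \<beta>) at_top \<and>
    (\<forall>\<^sub>F x in at_top. measure M {\<omega>\<in>space M. x \<le> (\<Sum>i\<in>UNIV. X i \<omega>)} / H x \<le> \<phi> x) \<and>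
    (\<forall>\<^sub>F x in at_top. \<phi> x \<le> measure M {\<omega>\<in>space M. (1 - e) * x \<le> (\<Sum>i\<in>UNIV. X i \<omega>)} / H x)"
proof -
  interpret prob_space M by fact
  let ?n = "real CARD('n)"
  have n: "?n \<ge> 1" by (simp add: Suc_le_eq)
  define d where "d = e / (2 * ?n)"
  have d: "d > 0" using e n by (simp add: d_def)
  have nd: "2 * ?n * d = e" using n by (simp add: d_def)
  \<comment> \<open>Truncation by \<open>nat\<close> puts all values below \<open>x * d\<close>, including negative ones, into cell \<open>0\<close>.\<close>
  define k where "k x i \<omega> = nat \<lfloor>X i \<omega> / (x * d)\<rfloor>" for x :: real and i \<omega>
  have [measurable]: "Measurable.pred M (\<lambda>\<omega>. \<forall>i. k x i \<omega> = m i)" for x m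
    unfolding k_def by measurable
  define Ms where "Ms = {m :: 'n \<Rightarrow> nat. d * (\<Sum>i\<in>UNIV. real (m i) + 1) \<le> 1}"
  define cell where "cell x m = {\<omega>\<in>space M. \<forall>i. k x i \<omega> = m i}" for x m
  have cell_sets: "cell x m \<in> sets M" for x m unfolding cell_def by measurable
  have fin: "finite Ms"
  proof (rule finite_subset)
    show "Ms \<subseteq> Pi\<^sub>E UNIV (\<lambda>_. {.. nat \<lfloor>1/d\<rfloor>})"
    proof
      fix m assume m: "m \<in> Ms"
      have "m j \<le> nat \<lfloor>1/d\<rfloor>" for j
      proof -
        have "real (m j) \<le> real (m j) + 1" by simp
        also have "\<dots> \<le> (\<Sum>i\<in>UNIV. real (m i) + 1)" by (rule member_le_sum) auto
        also have "\<dots> \<le> 1 / d" using m d by (simp add: Ms_def field_simps)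
        finally show ?thesis by (simp add: le_nat_floor)
      qed
      then show "m \<in> Pi\<^sub>E UNIV (\<lambda>_. {.. nat \<lfloor>1/d\<rfloor>})" by (auto simp: PiE_def)
    qed
    show "finite (Pi\<^sub>E (UNIV :: 'n set) (\<lambda>_. {.. nat \<lfloor>1/d\<rfloor>}))" by (rule finite_PiE) auto
  qed
  have k_eq: "k x i \<omega> = m \<longleftrightarrow> X i \<omega> < x * ((real m + 1) * d) \<and> (m \<ge> 1 \<longrightarrow> x * (real m * d) \<le> X i \<omega>)"
    if x: "x > 0" for x i \<omega> m
  proof -
    have xd: "x * d > 0" using x d by simp
    have 1: "X i \<omega> < x * ((real m + 1) * d) \<longleftrightarrow> X i \<omega> / (x * d) < real m + 1"
      using xd by (simp add: pos_divide_less_eq mult_ac)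
    have 2: "x * (real m * d) \<le> X i \<omega> \<longleftrightarrow> real m \<le> X i \<omega> / (x * d)"
      using xd by (simp add: pos_le_divide_eq mult_ac)
    show ?thesis unfolding 1 2 k_def by linarith
  qed
  have cell_lim: "\<exists>l. ((\<lambda>x. measure M (cell x m) / H x) \<longlongrightarrow> l) at_top" if "m \<noteq> (\<lambda>_. 0)" for m
  proof -
    have "{i. m i \<ge> 1} \<noteq> {}" using that by (auto simp: fun_eq_iff Suc_le_eq)
    then obtain l where l: "((\<lambda>x. measure M {\<omega>\<in>space M. (\<forall>i. X i \<omega> < x * ((real (m i) + 1) * d)) \<and>
         (\<forall>i\<in>{i. m i \<ge> 1}. x * (real (m i) * d) \<le> X i \<omega>)} / H x) \<longlongrightarrow> l) at_top"
      using cell_prob_convergent[OF assms(1) X joint, of "{i. m i \<ge> 1}" "\<lambda>i. real (m i) * d" "\<lambda>i. (real (m i)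
        + 1) * d"] d
      by auto
    have "((\<lambda>x. measure M (cell x m) / H x) \<longlongrightarrow> l) at_top"
    proof (rule Lim_transform_eventually[OF l])
      show "\<forall>\<^sub>F x in at_top. measure M {\<omega>\<in>space M. (\<forall>i. X i \<omega> < x * ((real (m i) + 1) * d)) \<and>
         (\<forall>i\<in>{i. m i \<ge> 1}. x * (real (m i) * d) \<le> X i \<omega>)} / H x = measure M (cell x m) / H x"
        using eventually_gt_at_top[of 0]
      proof eventually_elim
        case (elim x)
        have "{\<omega>\<in>space M. (\<forall>i. X i \<omega> < x * ((real (m i) + 1) * d)) \<and>
         (\<forall>i\<in>{i. m i \<ge> 1}. x * (real (m i) * d) \<le> X i \<omega>)} = cell x m"
          unfolding cell_def k_eq[OF elim] by auto
        then show ?case by simp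
      qed
    qed
    then show ?thesis by blast
  qed
  have zero_lim: "\<exists>l. ((\<lambda>x. (1 - measure M (cell x (\<lambda>_. 0))) / H x) \<longlongrightarrow> l) at_top"
  proof -
    obtain l where l: "((\<lambda>x. measure M {\<omega>\<in>space M. \<exists>i. X i \<omega> \<ge> x * d} / H x) \<longlongrightarrow> l) at_top"
      using joint[of "\<lambda>_. d"] d by auto
    have "((\<lambda>x. (1 - measure M (cell x (\<lambda>_. 0))) / H x) \<longlongrightarrow> l) at_top"
    proof (rule Lim_transform_eventually[OF l])
      show "\<forall>\<^sub>F x in at_top. measure M {\<omega>\<in>space M. \<exists>i. X i \<omega> \<ge> x * d} / H x
         = (1 - measure M (cell x (\<lambda>_. 0))) / H x"
        using eventually_gt_at_top[of 0]
      proof eventually_elim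
        case (elim x)
        have "{\<omega>\<in>space M. \<exists>i. X i \<omega> \<ge> x * d} = space M - cell x (\<lambda>_. 0)"
          unfolding cell_def k_eq[OF elim] by (auto simp flip: not_le)
        then show ?case by (simp add: prob_compl cell_sets)
      qed
    qed
    then show ?thesis by blast
  qed
  \<comment> \<open>\<open>B x\<close> says that the upper corners of the cells of the summands add up to more than \<open>x\<close>.
    Its complement is a finite union of cells and contains the cell at the origin.\<close>
  define B where "B x = {\<omega>\<in>space M. d * (\<Sum>i\<in>UNIV. real (k x i \<omega>) + 1) > 1}" for x
  have B_sets[measurable]: "B x \<in> sets M" for x unfolding B_def k_def by measurable
  have zero_in: "(\<lambda>_. 0) \<in> Ms" using nd e d by (simp add: Ms_def mult.commute)
  have B_meas: "measure M (B x)
    = (1 - measure M (cell x (\<lambda>_. 0))) - (\<Sum>m\<in>Ms - {\<lambda>_. 0}. measure M (cell x m))" for x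
  proof -
    have cell_iff: "\<omega> \<in> cell x m \<longleftrightarrow> \<omega> \<in> space M \<and> m = (\<lambda>i. k x i \<omega>)" for \<omega> m
      unfolding cell_def by auto
    have B_iff: "\<omega> \<in> B x \<longleftrightarrow> \<omega> \<in> space M \<and> (\<lambda>i. k x i \<omega>) \<notin> Ms" for \<omega>
      by (simp add: B_def Ms_def not_le)
    have eq: "B x = space M - (\<Union>m\<in>Ms. cell x m)"
      by (rule set_eqI) (auto simp: cell_iff B_iff)
    have "disjoint_family_on (cell x) Ms"
      unfolding disjoint_family_on_def by (auto simp: disjoint_iff cell_iff)
    then have "measure M (\<Union>m\<in>Ms. cell x m) = (\<Sum>m\<in>Ms. measure M (cell x m))"
      using cell_sets fin by (intro finite_measure_finite_Union) auto
    also have "\<dots> = measure M (cell x (\<lambda>_. 0)) + (\<Sum>m\<in>Ms - {\<lambda>_. 0}. measure M (cell x m))"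
      using fin zero_in by (rule sum.remove)
    finally show ?thesis unfolding eq using cell_sets fin by (subst prob_compl) auto
  qed
  have "\<exists>\<beta>. ((\<lambda>x. measure M (B x) / H x) \<longlongrightarrow> \<beta>) at_top"
  proof -
    obtain l0 where l0: "((\<lambda>x. (1 - measure M (cell x (\<lambda>_. 0))) / H x) \<longlongrightarrow> l0) at_top" using zero_lim by blast
    obtain l where l: "\<And>m. m \<noteq> (\<lambda>_. 0) \<Longrightarrow> ((\<lambda>x. measure M (cell x m) / H x) \<longlongrightarrow> l m) at_top"
      using cell_lim by metis
    have "((\<lambda>x. (1 - measure M (cell x (\<lambda>_. 0))) / H x - (\<Sum>m\<in>Ms - {\<lambda>_. 0}. measure M (cell x m) / H x))
       \<longlongrightarrow> l0 - (\<Sum>m\<in>Ms - {\<lambda>_. 0}. l m)) at_top"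
      by (intro tendsto_diff tendsto_sum l0 l) auto
    then show ?thesis unfolding B_meas by (auto simp: diff_divide_distrib sum_divide_distrib)
  qed
  then obtain \<beta> where \<beta>: "((\<lambda>x. measure M (B x) / H x) \<longlongrightarrow> \<beta>) at_top" by blast
  moreover have "\<forall>\<^sub>F x in at_top. measure M {\<omega>\<in>space M. x \<le> (\<Sum>i\<in>UNIV. X i \<omega>)} / H x \<le> measure M (B x) / H x"
    using Hpos eventually_gt_at_top[of 0]
  proof eventually_elim
    case (elim x)
    have "{\<omega>\<in>space M. x \<le> (\<Sum>i\<in>UNIV. X i \<omega>)} \<subseteq> B x"
    proof
      fix \<omega> assume \<omega>: "\<omega> \<in> {\<omega>\<in>space M. x \<le> (\<Sum>i\<in>UNIV. X i \<omega>)}"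
      have "x \<le> (\<Sum>i\<in>UNIV. X i \<omega>)" using \<omega> by simp
      also have "\<dots> < (\<Sum>i\<in>UNIV. x * ((real (k x i \<omega>) + 1) * d))"
        by (rule sum_strict_mono) (use k_eq[OF elim(2)] in auto)
      also have "\<dots> = x * (d * (\<Sum>i\<in>UNIV. real (k x i \<omega>) + 1))"
        by (simp add: sum_distrib_left mult_ac)
      finally have "1 < d * (\<Sum>i\<in>UNIV. real (k x i \<omega>) + 1)"
        using elim(2) by simp
      then show "\<omega> \<in> B x" using \<omega> by (simp add: B_def)
    qed
    then show ?case using elim by (intro divide_right_mono finite_measure_mono) auto
  qed
  moreover have "\<forall>\<^sub>F x in at_top. measure M (B x) / H x \<le> measure M {\<omega>\<in>space M. (1 - e) * x
    \<le> (\<Sum>i\<in>UNIV. X i \<omega>)} / H x"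
    using Hpos eventually_gt_at_top[of 0] eventually_ge_at_top[of "- c / d"]
  proof eventually_elim
    case (elim x)
    \<comment> \<open>The lower bound \<open>c\<close> is negligible on the scale \<open>x\<close>, so cell \<open>0\<close> also admits the lower corner \<open>- x * d\<close>.\<close>
    have xc: "- (x * d) \<le> c" using elim(3)[unfolded pos_divide_le_eq[OF d]] by simp
    have "AE \<omega> in M. \<forall>i. c \<le> X i \<omega>" using lower by (simp add: AE_all_countable)
    then have "AE \<omega> in M. \<omega> \<in> B x \<longrightarrow> \<omega> \<in> {\<omega>\<in>space M. (1 - e) * x \<le> (\<Sum>i\<in>UNIV. X i \<omega>)}"
    proof eventually_elim
      case (elim \<omega>)
      show ?case
      proof
        assume \<omega>: "\<omega> \<in> B x"
        have ki: "x * ((real (k x i \<omega>) - 1) * d) \<le> X i \<omega>" for i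
        proof (cases "k x i \<omega> \<ge> 1")
          case True
          then have "x * (real (k x i \<omega>) * d) \<le> X i \<omega>" using k_eq[OF \<open>0 < x\<close>, of i \<omega> "k x i \<omega>"] by auto
          moreover have "0 < x * d" using \<open>0 < x\<close> d by simp
          ultimately show ?thesis by (simp add: algebra_simps)
        next
          case False
          then have "k x i \<omega> = 0" by simp
          then show ?thesis using order_trans[OF xc elim[rule_format, of i]] by simp
        qed
        have "1 < d * (\<Sum>i\<in>UNIV. real (k x i \<omega>) + 1)" using \<omega> by (simp add: B_def)
        also have "\<dots> = d * (\<Sum>i\<in>UNIV. real (k x i \<omega>) - 1) + 2 * ?n * d"
          by (simp add: sum.distrib sum_subtractf algebra_simps)
        finally have "1 - e < d * (\<Sum>i\<in>UNIV. real (k x i \<omega>) - 1)" using nd by simp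
        then have "(1 - e) * x \<le> x * (d * (\<Sum>i\<in>UNIV. real (k x i \<omega>) - 1))"
          using \<open>0 < x\<close> by simp
        also have "\<dots> = (\<Sum>i\<in>UNIV. x * ((real (k x i \<omega>) - 1) * d))"
          by (simp add: sum_distrib_left mult_ac)
        also have "\<dots> \<le> (\<Sum>i\<in>UNIV. X i \<omega>)" by (rule sum_mono) (rule ki)
        finally show "\<omega> \<in> {\<omega>\<in>space M. (1 - e) * x \<le> (\<Sum>i\<in>UNIV. X i \<omega>)}" using \<omega> by (simp add: B_def)
      qed
    qed
    then show ?case using elim by (intro divide_right_mono finite_measure_mono_AE) auto
  qed
  ultimately show ?thesis by (intro exI[of _ "\<lambda>x. measure M (B x) / H x"] exI[of _ \<beta>] conjI)
qed

text \<open>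
  The number of levels among \<open>1, ..., K\<close> that \<open>s\<close> reaches: a discrete version of \<open>min s K\<close> whose
  expectation is a sum of tail probabilities.
\<close>
definition grid_count :: "nat \<Rightarrow> real \<Rightarrow> real" where
  "grid_count K s = (\<Sum>j=1..K. of_bool (real j \<le> s))"

lemma grid_count_eq: "grid_count K s = real (min K (nat \<lfloor>s\<rfloor>))"
proof -
  have "grid_count K s = real (card {j\<in>{1..K}. real j \<le> s})"
    unfolding grid_count_def by (simp add: of_bool_def sum.If_cases Int_def conj_commute)
  also have "{j\<in>{1..K}. real j \<le> s} = {1..min K (nat \<lfloor>s\<rfloor>)}"
    by (auto simp: le_nat_floor) linarith
  finally show ?thesis by simp
qed

text \<open>
  Together with \<open>sum_grid_count_le\<close>: the count of a sum differs from the sum of the counts by a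
  bounded amount, charged only when the sum or a summand reaches level \<open>1\<close>, and by a multiple of \<open>K\<close>, charged only when the sum
  reaches level \<open>K\<close>, an event of scaled probability of order \<open>1 / K\<close>.
\<close>
lemma grid_count_sum_le:
  fixes z :: "'n::finite \<Rightarrow> real"
  shows "grid_count K (\<Sum>i\<in>UNIV. z i)
    \<le> (\<Sum>i\<in>UNIV. grid_count K (z i)) + real CARD('n) * of_bool (1 \<le> (\<Sum>i\<in>UNIV. z i))"
proof -
  let ?s = "\<Sum>i\<in>UNIV. z i"
  have nn: "0 \<le> grid_count K s" for s by (simp add: grid_count_eq)
  consider "?s < 1" | i where "1 \<le> ?s" "real K \<le> z i" | "1 \<le> ?s" "\<forall>i. z i < real K"
    by (meson not_less)
  then show ?thesis
  proof cases
    case 1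
    then have "grid_count K ?s = 0" unfolding grid_count_eq by simp
    then show ?thesis using nn by (simp add: sum_nonneg)
  next
    case 2
    then have "grid_count K ?s \<le> grid_count K (z i)" unfolding grid_count_eq by linarith
    also have "\<dots> \<le> (\<Sum>i\<in>UNIV. grid_count K (z i))" by (rule member_le_sum) (auto simp: nn)
    finally show ?thesis by simp
  next
    case 3
    have "grid_count K ?s \<le> ?s" using 3(1) unfolding grid_count_eq by linarith
    also have "\<dots> \<le> (\<Sum>i\<in>UNIV. grid_count K (z i) + 1)"
    proof (rule sum_mono)
      fix i show "z i \<le> grid_count K (z i) + 1"
        using 3(2)[rule_format, of i] unfolding grid_count_eq by linarith
    qed
    finally show ?thesis using 3(1) by (simp add: sum.distrib)
  qed
qed

lemma sum_grid_count_le: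
  fixes z :: "'n::finite \<Rightarrow> real"
  assumes lower: "\<And>i. - 1 / real CARD('n) \<le> z i"
  shows "(\<Sum>i\<in>UNIV. grid_count K (z i)) \<le> grid_count K (\<Sum>i\<in>UNIV. z i)
     + (\<Sum>i\<in>UNIV. of_bool (1 \<le> z i)) + real CARD('n) * real K * of_bool (real K \<le> (\<Sum>i\<in>UNIV. z i))"
proof -
  let ?s = "\<Sum>i\<in>UNIV. z i" and ?n = "real CARD('n)"
  have nn: "0 \<le> grid_count K s" for s by (simp add: grid_count_eq)
  have nn': "0 \<le> (\<Sum>i\<in>UNIV. of_bool (1 \<le> z i) :: real)" by (rule sum_nonneg) simp
  have n: "?n > 0" by simp
  consider "real K \<le> ?s" | "\<forall>i. z i < 1" | i where "?s < real K" "1 \<le> z i" by (meson not_less)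
  then show ?thesis
  proof cases
    case 1
    have "(\<Sum>i\<in>UNIV. grid_count K (z i)) \<le> (\<Sum>i\<in>(UNIV::'n set). real K)"
      by (rule sum_mono) (simp add: grid_count_eq)
    then show ?thesis using 1 nn[of ?s] nn' by simp
  next
    case 2
    then have "grid_count K (z i) = 0" for i unfolding grid_count_eq by simp
    then show ?thesis using nn[of ?s] nn' by simp
  next
    case 3
    define m where "m = (\<Sum>i\<in>UNIV. min K (nat \<lfloor>z i\<rfloor>))"
    have m: "(\<Sum>i\<in>UNIV. grid_count K (z i)) = real m" unfolding grid_count_eq m_def by simp
    have "real m \<le> (\<Sum>i\<in>UNIV. z i + 1 / ?n)"
      unfolding m[symmetric]
    proof (rule sum_mono)
      fix i
      have "0 < 1 / ?n" "- (1 / ?n) \<le> z i" using n lower[of i] by simp_all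
      moreover have "real (min K (nat \<lfloor>z i\<rfloor>)) \<le> max 0 (z i)" by linarith
      ultimately show "grid_count K (z i) \<le> z i + 1 / ?n" unfolding grid_count_eq by linarith
    qed
    also have "\<dots> = ?s + 1" by (simp add: sum.distrib)
    finally have ms: "real m - 1 \<le> ?s" by simp
    have "m - 1 \<le> min K (nat \<lfloor>?s\<rfloor>)"
    proof (cases "m = 0")
      case False
      then have "real (m - 1) \<le> ?s" using ms by simp
      then show ?thesis using 3(1) by (simp add: le_nat_floor)
    qed simp
    then have "real m \<le> grid_count K ?s + 1" unfolding grid_count_eq by linarith
    moreover have "1 \<le> (\<Sum>i\<in>UNIV. of_bool (1 \<le> z i) :: real)"
      using member_le_sum[of i UNIV "\<lambda>i. of_bool (1 \<le> z i) :: real"] 3(2) by simp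
    moreover have "0 \<le> ?n * real K * of_bool (real K \<le> ?s)" by simp
    ultimately show ?thesis using m by linarith
  qed
qed

lemma le_of_harmonic_le:
  fixes a b C :: real
  assumes "\<And>K. K \<ge> 1 \<Longrightarrow> a * harm K \<le> b * harm K + C"
  shows "a \<le> b"
proof (rule ccontr)
  assume "\<not> a \<le> b"
  then have ab: "a - b > 0" by simp
  have "\<forall>\<^sub>F K in sequentially. harm K > C / (a - b)"
    using harm_at_top by (simp add: filterlim_at_top_dense)
  then have "\<forall>\<^sub>F K in sequentially. False"
    using eventually_ge_at_top[of 1]
  proof eventually_elim
    case (elim K)
    from elim(1) have "C < (a - b) * harm K" using ab by (simp add: pos_divide_less_eq mult.commute)
    then show False using assms[OF elim(2)] by (simp add: algebra_simps)
  qed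
  then show False by simp
qed

text \<open>
  For tails of index \<open>1\<close> the tail of a sum is asymptotic to the sum of the tails, for every
  dependence structure under which the joint tails converge.
\<close>
lemma sum_tail_limit:
  fixes X :: "'n::finite \<Rightarrow> 'a \<Rightarrow> real" and H :: "real \<Rightarrow> real"
  assumes "prob_space M" and X[measurable]: "\<And>i. X i \<in> borel_measurable M"
    and lower: "\<And>i. AE \<omega> in M. c \<le> X i \<omega>"
    and Hpos: "\<forall>\<^sub>F x in at_top. H x > 0"
    and HRV: "\<And>y. y > 0 \<Longrightarrow> ((\<lambda>x. H (x * y) / H x) \<longlongrightarrow> 1 / y) at_top"
    and joint: "\<And>a. (\<And>i. a i > 0) \<Longrightarrow>
      \<exists>l. ((\<lambda>x. measure M {\<omega>\<in>space M. \<exists>i. X i \<omega> \<ge> x * a i} / H x) \<longlongrightarrow> l) at_top"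
    and marg: "\<And>i. ((\<lambda>x. measure M {\<omega>\<in>space M. x \<le> X i \<omega>} / H x) \<longlongrightarrow> \<Lambda> i) at_top"
  shows "((\<lambda>x. measure M {\<omega>\<in>space M. x \<le> (\<Sum>i\<in>UNIV. X i \<omega>)} / H x) \<longlongrightarrow> (\<Sum>i\<in>UNIV. \<Lambda> i)) at_top"
proof -
  interpret prob_space M by fact
  let ?n = "real CARD('n)"
  define S where "S \<omega> = (\<Sum>i\<in>UNIV. X i \<omega>)" for \<omega>
  have S_meas[measurable]: "S \<in> borel_measurable M" unfolding S_def by measurable
  define p where "p Y y = measure M {\<omega>\<in>space M. y \<le> Y \<omega>}" for Y and y :: real
  define L where "L = (\<Sum>i\<in>UNIV. \<Lambda> i)"
  have lim_mult: "filterlim (\<lambda>x. x * y) at_top at_top" if "y > 0" for y :: real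
    using filterlim_tendsto_pos_mult_at_top[OF tendsto_const that filterlim_ident] by (simp add: mult.commute)
  have scale: "((\<lambda>x. f (x * y) / H x) \<longlongrightarrow> l / y) at_top"
    if "((\<lambda>x. f x / H x) \<longlongrightarrow> l) at_top" "y > 0" for f l y
  proof -
    have inf: "filterlim (\<lambda>x. x * y) at_top at_top" by (rule lim_mult[OF that(2)])
    have "((\<lambda>x. f (x * y) / H (x * y) * (H (x * y) / H x)) \<longlongrightarrow> l * (1 / y)) at_top"
      by (intro tendsto_mult HRV that(2) filterlim_compose[OF that(1) inf])
    moreover have "\<forall>\<^sub>F x in at_top. f (x * y) / H (x * y) * (H (x * y) / H x) = f (x * y) / H x"
      using Hpos inf[unfolded filterlim_iff, rule_format, OF Hpos]
      by eventually_elim simp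
    ultimately have "((\<lambda>x. f (x * y) / H x) \<longlongrightarrow> l * (1 / y)) at_top"
      by (rule Lim_transform_eventually)
    then show ?thesis by simp
  qed
  have pX: "((\<lambda>x. p (X i) (x * y) / H x) \<longlongrightarrow> \<Lambda> i / y) at_top" if "y > 0" for i y
    using scale[OF marg that] unfolding p_def by simp
  have pX0: "((\<lambda>x. p (X i) x / H x) \<longlongrightarrow> \<Lambda> i) at_top" for i
    using marg unfolding p_def by simp
  have E_of_bool: "(\<integral>\<omega>. of_bool (y \<le> Y \<omega>) \<partial>M) = p Y y"
    if [measurable]: "Y \<in> borel_measurable M" for Y and y :: real
  proof -
    have "(\<integral>\<omega>. of_bool (y \<le> Y \<omega>) \<partial>M) = (\<integral>\<omega>. indicator {\<omega>\<in>space M. y \<le> Y \<omega>} \<omega> \<partial>M)"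
      by (rule Bochner_Integration.integral_cong) (auto simp: indicator_def)
    also have "\<dots> = measure M ({\<omega>\<in>space M. y \<le> Y \<omega>} \<inter> space M)" by simp
    also have "{\<omega>\<in>space M. y \<le> Y \<omega>} \<inter> space M = {\<omega>\<in>space M. y \<le> Y \<omega>}" by auto
    finally show ?thesis unfolding p_def .
  qed
  have I_of_bool: "integrable M (\<lambda>\<omega>. of_bool (y \<le> Y \<omega>) :: real)"
    if [measurable]: "Y \<in> borel_measurable M" for Y and y :: real
  proof -
    have "integrable M (indicat_real {\<omega>\<in>space M. y \<le> Y \<omega>})"
      by (rule integrable_real_indicator) (auto simp: emeasure_eq_measure)
    then show ?thesis
      by (rule Bochner_Integration.integrable_cong[THEN iffD1, rotated -1]) auto
  qed
  have count: "grid_count K (Y \<omega> / x) = (\<Sum>j=1..K. of_bool (x * real j \<le> Y \<omega>))" if "x > 0" for K Y x \<omega>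
    unfolding grid_count_def using that by (simp add: pos_le_divide_eq mult.commute)
  have S_div: "S \<omega> / x = (\<Sum>i\<in>UNIV. X i \<omega> / x)" for \<omega> x by (simp add: S_def sum_divide_distrib)
  have upper: "(\<Sum>j=1..K. p S (x * real j)) \<le> (\<Sum>i\<in>UNIV. \<Sum>j=1..K. p (X i) (x * real j)) + ?n * p S x"
    if x: "x > 0" for x K
  proof -
    have "(\<integral>\<omega>. (\<Sum>j=1..K. of_bool (x * real j \<le> S \<omega>)) \<partial>M)
      \<le> (\<integral>\<omega>. (\<Sum>i\<in>UNIV. \<Sum>j=1..K. of_bool (x * real j \<le> X i \<omega>)) + ?n * of_bool (x \<le> S \<omega>) \<partial>M)"
    proof (rule integral_mono)
      fix \<omega>
      show "(\<Sum>j=1..K. of_bool (x * real j \<le> S \<omega>)) \<le> (\<Sum>i\<in>UNIV. \<Sum>j=1..K. of_bool (x * real j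
        \<le> X i \<omega>)) + ?n * of_bool (x \<le> S \<omega>)"
        using grid_count_sum_le[of K "\<lambda>i. X i \<omega> / x"] x
        unfolding S_div[symmetric] count[OF x] by simp
    qed (intro Bochner_Integration.integrable_sum Bochner_Integration.integrable_add integrable_mult_right I_of_bool X S_meas)+
    then show ?thesis
      by (simp del: sum_of_bool_eq add: I_of_bool E_of_bool Bochner_Integration.integral_sum Bochner_Integration.integrable_sum)
  qed
  have lowerb: "\<forall>\<^sub>F x in at_top. (\<Sum>i\<in>UNIV. \<Sum>j=1..K. p (X i) (x * real j))
     \<le> (\<Sum>j=1..K. p S (x * real j)) + (\<Sum>i\<in>UNIV. p (X i) x) + ?n * real K * p S (x * real K)" for K
    using eventually_gt_at_top[of 0] eventually_ge_at_top[of "\<bar>c\<bar> * ?n"]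
  proof eventually_elim
    case (elim x)
    have x: "x > 0" by fact
    have "- (\<bar>c\<bar> * ?n) \<le> c * ?n" using mult_right_mono[of "- \<bar>c\<bar>" c ?n] by simp
    then have cx: "- 1 / ?n \<le> c / x" using elim by (simp add: field_simps)
    have ae: "AE \<omega> in M. \<forall>i. c \<le> X i \<omega>" using lower by (simp add: AE_all_countable)
    have "(\<integral>\<omega>. (\<Sum>i\<in>UNIV. \<Sum>j=1..K. of_bool (x * real j \<le> X i \<omega>)) \<partial>M)
      \<le> (\<integral>\<omega>. (\<Sum>j=1..K. of_bool (x * real j \<le> S \<omega>)) + (\<Sum>i\<in>UNIV. of_bool (x
        \<le> X i \<omega>)) + ?n * real K * of_bool (x * real K \<le> S \<omega>) \<partial>M)"
    proof (rule integral_mono_AE)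
      show "AE \<omega> in M. (\<Sum>i\<in>UNIV. \<Sum>j=1..K. of_bool (x * real j \<le> X i \<omega>))
        \<le> (\<Sum>j=1..K. of_bool (x * real j \<le> S \<omega>)) + (\<Sum>i\<in>UNIV. of_bool (x
          \<le> X i \<omega>)) + ?n * real K * of_bool (x * real K \<le> S \<omega>)"
        using ae
      proof eventually_elim
        case (elim \<omega>)
        have "- 1 / ?n \<le> X i \<omega> / x" for i
          using cx divide_right_mono[OF elim[rule_format, of i], of x] x by linarith
        from sum_grid_count_le[of "\<lambda>i. X i \<omega> / x" K, OF this] show ?case
          using x unfolding S_div[symmetric] count[OF x] by (simp add: pos_le_divide_eq mult.commute)
      qed
    qed (intro Bochner_Integration.integrable_sum Bochner_Integration.integrable_add integrable_mult_right I_of_bool X S_meas)+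
    then show ?case
      by (simp del: sum_of_bool_eq add: I_of_bool E_of_bool Bochner_Integration.integral_sum Bochner_Integration.integrable_sum
          Bochner_Integration.integrable_add)
  qed
  have harm_sum: "(\<Sum>j=1..K. a / real j) = a * harm K" for a K
    by (simp add: harm_def sum_distrib_left divide_inverse)
  \<comment> \<open>The limit \<open>\<beta>\<close> of the grid approximation satisfies \<open>L \<le> \<beta> \<le> L / (1 - e)\<close>: the tail of the sum at
    level \<open>x * j\<close> contributes about \<open>\<beta> / j\<close>, and summation over \<open>j \<le> K\<close> leaves errors bounded in \<open>K\<close>.\<close>
  have bounds: "\<exists>\<phi> \<beta>. (\<phi> \<longlongrightarrow> \<beta>) at_top \<and> L \<le> \<beta> \<and> (1 - e) * \<beta> \<le> L \<and>
    (\<forall>\<^sub>F x in at_top. p S x / H x \<le> \<phi> x) \<and>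
    (\<forall>\<^sub>F x in at_top. \<phi> (x * (1 / (1 - e))) * H (x * (1 / (1 - e))) / H x \<le> p S x / H x) \<and>
    ((\<lambda>x. \<phi> (x * (1 / (1 - e))) * H (x * (1 / (1 - e))) / H x) \<longlongrightarrow> (1 - e) * \<beta>) at_top"
    if e: "0 < e" "e < 1" for e
  proof -
    obtain \<phi> \<beta> where \<phi>: "(\<phi> \<longlongrightarrow> \<beta>) at_top"
      and le: "\<forall>\<^sub>F x in at_top. p S x / H x \<le> \<phi> x"
      and ge: "\<forall>\<^sub>F x in at_top. \<phi> x \<le> p S ((1 - e) * x) / H x"
      using sum_tail_grid_approximation[OF assms(1) X lower Hpos joint e] unfolding p_def S_def by blast
    define q where "q = 1 / (1 - e)"
    have q: "q > 0" using e by (simp add: q_def)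
    have \<phi>H: "((\<lambda>x. \<phi> (x * y) * H (x * y) / H x) \<longlongrightarrow> \<beta> / y) at_top" if "y > 0" for y
      using tendsto_mult[OF filterlim_compose[OF \<phi> lim_mult[OF that]] HRV[OF that]] by simp
    have le': "\<forall>\<^sub>F x in at_top. p S (x * y) / H x \<le> \<phi> (x * y) * H (x * y) / H x" if "y > 0" for y
      using lim_mult[OF that, unfolded filterlim_iff, rule_format, OF le] Hpos
        lim_mult[OF that, unfolded filterlim_iff, rule_format, OF Hpos]
      by eventually_elim (simp add: divide_right_mono pos_divide_le_eq)
    have ge': "\<forall>\<^sub>F x in at_top. \<phi> (x * (y * q)) * H (x * (y * q)) / H x \<le> p S (x * y) / H x" if "y > 0" for y
      using lim_mult[OF mult_pos_pos[OF that q], unfolded filterlim_iff, rule_format, OF ge] Hpos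
        lim_mult[OF mult_pos_pos[OF that q], unfolded filterlim_iff, rule_format, OF Hpos]
    proof eventually_elim
      case (elim x)
      have "(1 - e) * (x * (y * q)) = x * y" using e by (simp add: q_def)
      with elim show ?case by (simp add: divide_right_mono pos_le_divide_eq)
    qed
    have "L \<le> \<beta>"
    proof (rule le_of_harmonic_le)
      fix K :: nat assume K: "K \<ge> 1"
      have "(\<Sum>i\<in>UNIV. \<Sum>j=1..K. \<Lambda> i / real j)
        \<le> (\<Sum>j=1..K. \<beta> / real j) + (\<Sum>i\<in>UNIV. \<Lambda> i) + ?n * real K * (\<beta> / real K)"
      proof (rule tendsto_le[OF trivial_limit_at_top_linorder])
        show "((\<lambda>x. \<Sum>i\<in>UNIV. \<Sum>j=1..K. p (X i) (x * real j) / H x) \<longlongrightarrow> (\<Sum>i\<in>UNIV. \<Sum>j=1..K. \<Lambda> i / real j)) at_top"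
          by (intro tendsto_sum pX) auto
        show "((\<lambda>x. (\<Sum>j=1..K. \<phi> (x * real j) * H (x * real j) / H x) + (\<Sum>i\<in>UNIV. p (X i) x / H x)
            + ?n * real K * (\<phi> (x * real K) * H (x * real K) / H x)) \<longlongrightarrow>
            (\<Sum>j=1..K. \<beta> / real j) + (\<Sum>i\<in>UNIV. \<Lambda> i) + ?n * real K * (\<beta> / real K)) at_top"
          using K by (intro tendsto_add tendsto_mult_left tendsto_sum \<phi>H pX0) auto
        have "\<forall>\<^sub>F x in at_top. \<forall>j\<in>{1..K}. p S (x * real j) / H x \<le> \<phi> (x * real j) * H (x * real j) / H x"
          by (intro eventually_ball_finite ballI le') auto
        then show "\<forall>\<^sub>F x in at_top. (\<Sum>i\<in>UNIV. \<Sum>j=1..K. p (X i) (x * real j) / H x) \<le>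
            (\<Sum>j=1..K. \<phi> (x * real j) * H (x * real j) / H x) + (\<Sum>i\<in>UNIV. p (X i) x / H x)
            + ?n * real K * (\<phi> (x * real K) * H (x * real K) / H x)"
          using lowerb[of K] Hpos
        proof eventually_elim
          case (elim x)
          have "(\<Sum>i\<in>UNIV. \<Sum>j=1..K. p (X i) (x * real j) / H x) =
             (\<Sum>i\<in>UNIV. \<Sum>j=1..K. p (X i) (x * real j)) / H x" by (simp add: sum_divide_distrib)
          also have "\<dots> \<le> ((\<Sum>j=1..K. p S (x * real j)) + (\<Sum>i\<in>UNIV. p (X i) x)
            + ?n * real K * p S (x * real K)) / H x"
            using elim by (intro divide_right_mono) auto
          also have "\<dots> = (\<Sum>j=1..K. p S (x * real j) / H x) + (\<Sum>i\<in>UNIV. p (X i) x / H x)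
            + ?n * real K * (p S (x * real K) / H x)"
            by (simp add: sum_divide_distrib add_divide_distrib)
          also have "\<dots> \<le> (\<Sum>j=1..K. \<phi> (x * real j) * H (x * real j) / H x) + (\<Sum>i\<in>UNIV. p (X i) x / H x)
            + ?n * real K * (\<phi> (x * real K) * H (x * real K) / H x)"
            using elim(1) K by (intro add_mono mult_left_mono sum_mono) auto
          finally show ?case .
        qed
      qed
      then show "L * harm K \<le> \<beta> * harm K + (L + ?n * \<beta>)"
        using K unfolding harm_sum by (simp add: L_def sum_distrib_right)
    qed
    moreover have "(1 - e) * \<beta> \<le> L"
    proof (rule le_of_harmonic_le)
      fix K :: nat assume K: "K \<ge> 1"
      have "(\<Sum>j=1..K. \<beta> / (real j * q)) \<le> (\<Sum>i\<in>UNIV. \<Sum>j=1..K. \<Lambda> i / real j) + ?n * \<beta>"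
      proof (rule tendsto_le[OF trivial_limit_at_top_linorder])
        show "((\<lambda>x. (\<Sum>i\<in>UNIV. \<Sum>j=1..K. p (X i) (x * real j) / H x) + ?n * \<phi> x)
          \<longlongrightarrow> (\<Sum>i\<in>UNIV. \<Sum>j=1..K. \<Lambda> i / real j) + ?n * \<beta>) at_top"
          by (intro tendsto_add tendsto_mult_left tendsto_sum pX \<phi>) auto
        show "((\<lambda>x. \<Sum>j=1..K. \<phi> (x * (real j * q)) * H (x * (real j * q)) / H x)
          \<longlongrightarrow> (\<Sum>j=1..K. \<beta> / (real j * q))) at_top"
          using q by (intro tendsto_sum \<phi>H) auto
        have "\<forall>\<^sub>F x in at_top. \<forall>j\<in>{1..K}. \<phi> (x * (real j * q)) * H (x * (real j * q)) / H x
          \<le> p S (x * real j) / H x"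
          by (intro eventually_ball_finite ballI ge') auto
        then show "\<forall>\<^sub>F x in at_top. (\<Sum>j=1..K. \<phi> (x * (real j * q)) * H (x * (real j * q)) / H x) \<le>
            (\<Sum>i\<in>UNIV. \<Sum>j=1..K. p (X i) (x * real j) / H x) + ?n * \<phi> x"
          using le Hpos eventually_gt_at_top[of 0]
        proof eventually_elim
          case (elim x)
          have "(\<Sum>j=1..K. \<phi> (x * (real j * q)) * H (x * (real j * q)) / H x)
            \<le> (\<Sum>j=1..K. p S (x * real j) / H x)"
            using elim(1) by (intro sum_mono) auto
          also have "\<dots> = (\<Sum>j=1..K. p S (x * real j)) / H x" by (simp add: sum_divide_distrib)
          also have "\<dots> \<le> ((\<Sum>i\<in>UNIV. \<Sum>j=1..K. p (X i) (x * real j)) + ?n * p S x) / H x"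
            using elim by (intro divide_right_mono upper) auto
          also have "\<dots> = (\<Sum>i\<in>UNIV. \<Sum>j=1..K. p (X i) (x * real j) / H x) + ?n * (p S x / H x)"
            by (simp add: sum_divide_distrib add_divide_distrib)
          also have "\<dots> \<le> (\<Sum>i\<in>UNIV. \<Sum>j=1..K. p (X i) (x * real j) / H x) + ?n * \<phi> x"
            using elim by (intro add_left_mono mult_left_mono) auto
          finally show ?case .
        qed
      qed
      moreover have "\<beta> / (real j * q) = (1 - e) * \<beta> / real j" for j using e by (simp add: q_def field_simps)
      ultimately show "(1 - e) * \<beta> * harm K \<le> L * harm K + ?n * \<beta>"
        by (simp only: harm_sum L_def flip: sum_distrib_right)
    qed
    ultimately show ?thesis
      using \<phi> le ge'[of 1] \<phi>H[OF q] e
      by (intro exI[of _ \<phi>] exI[of _ \<beta>]) (simp add: q_def mult.commute)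
  qed
  have lam_nn: "0 \<le> \<Lambda> i" for i
    by (rule tendsto_lowerbound[OF pX0]) (use Hpos in \<open>auto elim!: eventually_mono simp: p_def\<close>)
  then have L: "0 \<le> L" unfolding L_def by (simp add: sum_nonneg)
  have "((\<lambda>x. p S x / H x) \<longlongrightarrow> L) at_top"
  proof (rule order_tendstoI)
    fix u assume u: "L < u"
    \<comment> \<open>Any \<open>e\<close> with \<open>(1 - e) * u > L\<close> serves.\<close>
    define e where "e = (u - L) / (2 * (u + 1))"
    have e: "0 < e" "e < 1" using u L by (auto simp: e_def field_simps)
    have "(1 - e) * u > L"
    proof -
      have "(u - L) * (u / (2 * (u + 1))) < (u - L) * 1"
        using u L by (intro mult_strict_left_mono) (auto simp: field_simps)
      then have "e * u < u - L" by (simp add: e_def)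
      then show ?thesis by (simp add: algebra_simps)
    qed
    obtain \<phi> \<beta> where \<phi>: "(\<phi> \<longlongrightarrow> \<beta>) at_top" "(1 - e) * \<beta> \<le> L" and le: "\<forall>\<^sub>F x in at_top. p S x / H x \<le> \<phi> x"
      using bounds[OF e] by blast
    have "(1 - e) * \<beta> < (1 - e) * u" using \<phi>(2) \<open>(1 - e) * u > L\<close> by linarith
    then have "\<beta> < u" using e by simp
    from order_tendstoD(2)[OF \<phi>(1) this] le show "\<forall>\<^sub>F x in at_top. p S x / H x < u"
      by eventually_elim simp
  next
    fix l assume l: "l < L"
    \<comment> \<open>Any \<open>e\<close> with \<open>(1 - e) * L > l\<close> serves.\<close>
    define e where "e = (L - l) / (2 * (L + \<bar>l\<bar> + 1))"
    have e: "0 < e" "e < 1" using l L by (auto simp: e_def field_simps)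
    have "(L - l) * (L / (2 * (L + \<bar>l\<bar> + 1))) < (L - l) * 1"
      using l L by (intro mult_strict_left_mono) (auto simp: field_simps)
    then have "e * L < L - l" by (simp add: e_def)
    then have 1: "(1 - e) * L > l" by (simp add: algebra_simps)
    obtain \<phi> \<beta> where \<phi>: "L \<le> \<beta>"
      and ge: "\<forall>\<^sub>F x in at_top. \<phi> (x * (1 / (1 - e))) * H (x * (1 / (1 - e))) / H x \<le> p S x / H x"
      and lim: "((\<lambda>x. \<phi> (x * (1 / (1 - e))) * H (x * (1 / (1 - e))) / H x) \<longlongrightarrow> (1 - e) * \<beta>) at_top"
      using bounds[OF e] by blast
    have "l < (1 - e) * \<beta>" using mult_left_mono[OF \<phi>, of "1 - e"] e 1 by linarith
    from order_tendstoD(1)[OF lim this] ge show "\<forall>\<^sub>F x in at_top. l < p S x / H x"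
      by eventually_elim simp
  qed
  then show ?thesis unfolding p_def S_def L_def .
qed

section \<open>Copulas and their exponent functions\<close>

lemma copula_lipschitz:
  assumes "is_copula C" and u: "u \<in> unit_cube" and v: "v \<in> unit_cube"
  shows "\<bar>C u - C v\<bar> \<le> (\<Sum>i\<in>UNIV. \<bar>u $ i - v $ i\<bar>)"
proof -
  obtain \<mu> where \<mu>: "prob_space \<mu>" and sets[measurable_cong]: "sets \<mu> = sets borel"
    and marg: "\<And>i. distr \<mu> borel (\<lambda>x. x $ i) = uniform_measure lborel {0..1}"
    and C: "\<And>u. u \<in> unit_cube \<Longrightarrow> C u = measure \<mu> {x. \<forall>i. x $ i \<le> u $ i}"
    using assms(1) unfolding is_copula_def by blast
  interpret prob_space \<mu> by fact
  have sp: "space \<mu> = UNIV" using sets_eq_imp_space_eq[OF sets] by simp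
  have S[measurable]: "{x. P x} \<in> sets \<mu>" if "Measurable.pred borel P" for P :: "real ^ 'a \<Rightarrow> bool"
    using that sets by (simp add: pred_def)
  have strip: "measure \<mu> {x. v $ i < x $ i \<and> x $ i \<le> u $ i} \<le> \<bar>u $ i - v $ i\<bar>"
    if u: "u \<in> unit_cube" and v: "v \<in> unit_cube" for u v :: "real ^ 'a" and i
  proof (cases "v $ i \<le> u $ i")
    case True
    have v01: "0 \<le> v $ i" "u $ i \<le> 1" using u v by (simp_all add: unit_cube_def)
    have "measure \<mu> {x. v $ i < x $ i \<and> x $ i \<le> u $ i} = measure (distr \<mu> borel (\<lambda>x. x $ i)) {v $ i <.. u $ i}"
      by (subst measure_distr) (auto simp: sp vimage_def intro!: arg_cong[where f="measure \<mu>"])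
    also have "\<dots> = measure lborel ({0..1} \<inter> {v $ i <.. u $ i})"
      unfolding marg by (subst measure_uniform_measure) auto
    also have "{0..1} \<inter> {v $ i <.. u $ i} = {v $ i <.. u $ i}"
      using v01 by auto
    finally show ?thesis using True by simp
  next
    case False
    then have "{x. v $ i < x $ i \<and> x $ i \<le> u $ i} = {}" by auto
    then show ?thesis by (simp only: measure_empty abs_ge_zero)
  qed
  have half: "C u \<le> C v + (\<Sum>i\<in>UNIV. \<bar>u $ i - v $ i\<bar>)"
    if u: "u \<in> unit_cube" and v: "v \<in> unit_cube" for u v :: "real ^ 'a"
  proof -
    have "C u \<le> measure \<mu> ({x. \<forall>i. x $ i \<le> v $ i} \<union> (\<Union>i. {x. v $ i < x $ i \<and> x $ i \<le> u $ i}))"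
      unfolding C[OF u] by (rule finite_measure_mono) (auto simp: not_le)
    also have "\<dots> \<le> C v + measure \<mu> (\<Union>i. {x. v $ i < x $ i \<and> x $ i \<le> u $ i})"
      unfolding C[OF v] by (rule measure_Un_le) auto
    also have "measure \<mu> (\<Union>i. {x. v $ i < x $ i \<and> x $ i \<le> u $ i})
        \<le> (\<Sum>i\<in>UNIV. measure \<mu> {x. v $ i < x $ i \<and> x $ i \<le> u $ i})"
      by (rule measure_UNION_le) auto
    also have "\<dots> \<le> (\<Sum>i\<in>UNIV. \<bar>u $ i - v $ i\<bar>)"
      by (rule sum_mono) (rule strip[OF u v])
    finally show ?thesis by simp
  qed
  have "(\<Sum>i\<in>UNIV. \<bar>v $ i - u $ i\<bar>) = (\<Sum>i\<in>UNIV. \<bar>u $ i - v $ i\<bar>)"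
    by (simp add: abs_minus_commute)
  then show ?thesis using half[OF u v] half[OF v u] by linarith
qed

lemma copula_le_coord:
  assumes "is_copula C" and u: "u \<in> unit_cube"
  shows "C u \<le> u $ i"
proof -
  obtain \<mu> where \<mu>: "prob_space \<mu>" and sets[measurable_cong]: "sets \<mu> = sets borel"
    and marg: "\<And>i. distr \<mu> borel (\<lambda>x. x $ i) = uniform_measure lborel {0..1}"
    and C: "\<And>u. u \<in> unit_cube \<Longrightarrow> C u = measure \<mu> {x. \<forall>i. x $ i \<le> u $ i}"
    using assms(1) unfolding is_copula_def by blast
  interpret prob_space \<mu> by fact
  have sp: "space \<mu> = UNIV" using sets_eq_imp_space_eq[OF sets] by simp
  have "{x :: real ^ 'a. x $ i \<le> u $ i} \<in> sets borel" by measurable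
  then have "C u \<le> measure \<mu> {x. x $ i \<le> u $ i}"
    unfolding C[OF u] using sets by (intro finite_measure_mono) auto
  also have "\<dots> = measure (distr \<mu> borel (\<lambda>x. x $ i)) {.. u $ i}"
    by (subst measure_distr) (auto simp: sp vimage_def intro!: arg_cong[where f="measure \<mu>"])
  also have "\<dots> = measure lborel ({0..1} \<inter> {.. u $ i})"
    unfolding marg by (subst measure_uniform_measure) auto
  also have "{0..1} \<inter> {.. u $ i} = {0.. u $ i}"
    using u by (auto simp: unit_cube_def intro: order_trans)
  finally show ?thesis using u by (simp add: unit_cube_def)
qed

lemma copula_D_lipschitz:
  assumes "is_copula C" and "u \<in> unit_cube" and "v \<in> unit_cube"
  shows "\<bar>copula_D C u - copula_D C v\<bar> \<le> (\<Sum>i\<in>UNIV. \<bar>u $ i - v $ i\<bar>)"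
proof -
  have "\<bar>C (\<chi> i. 1 - u $ i) - C (\<chi> i. 1 - v $ i)\<bar> \<le> (\<Sum>i\<in>UNIV. \<bar>(1 - u $ i) - (1 - v $ i)\<bar>)"
    using copula_lipschitz[OF assms(1), of "\<chi> i. 1 - u $ i" "\<chi> i. 1 - v $ i"] assms(2,3)
    by (simp add: unit_cube_def)
  then show ?thesis by (simp add: copula_D_def abs_minus_commute)
qed

lemma copula_D_ge_coord:
  assumes "is_copula C" and "u \<in> unit_cube"
  shows "u $ i \<le> copula_D C u"
  using copula_le_coord[OF assms(1), of "\<chi> i. 1 - u $ i" i] assms(2)
  by (simp add: unit_cube_def copula_D_def)

text \<open>
  By the Lipschitz bound, the limit along rays that defines an MRV copula extends to arguments that
  are only asymptotic to a ray.
\<close>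
lemma copula_D_tendsto:
  fixes C :: "real ^ 'n \<Rightarrow> real"
  assumes C: "is_copula C"
    and l: "\<And>v. (\<And>i. 0 \<le> v $ i) \<Longrightarrow> ((\<lambda>s. copula_D C (s *\<^sub>R v) / s) \<longlongrightarrow> l v) (at_right 0)"
    and s: "filterlim s (at_right 0) F"
    and g: "\<And>i. ((\<lambda>x. g x $ i / s x) \<longlongrightarrow> v $ i) F"
    and cube: "\<forall>\<^sub>F x in F. g x \<in> unit_cube" and v: "\<And>i. 0 \<le> v $ i"
  shows "((\<lambda>x. copula_D C (g x) / s x) \<longlongrightarrow> l v) F"
proof -
  have spos: "\<forall>\<^sub>F x in F. 0 < s x"
    using s by (simp add: filterlim_at eventually_conj_iff)
  have s0: "(s \<longlongrightarrow> 0) F" using s by (simp add: filterlim_at)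
  have "((\<lambda>x. copula_D C (g x) / s x - copula_D C (s x *\<^sub>R v) / s x) \<longlongrightarrow> 0) F"
  proof (rule Lim_null_comparison)
    have "((\<lambda>x. \<Sum>i\<in>UNIV. \<bar>g x $ i / s x - v $ i\<bar>) \<longlongrightarrow> (\<Sum>i\<in>UNIV. \<bar>v $ i - v $ i\<bar>)) F"
      by (intro tendsto_sum tendsto_rabs tendsto_diff g tendsto_const)
    then show "((\<lambda>x. \<Sum>i\<in>UNIV. \<bar>g x $ i / s x - v $ i\<bar>) \<longlongrightarrow> 0) F" by simp
    have "\<forall>\<^sub>F x in F. s x * v $ i < 1" for i
      using order_tendstoD(2)[OF tendsto_mult_left_zero[OF s0], of 1 "v $ i"] by simp
    then have "\<forall>\<^sub>F x in F. \<forall>i. s x * v $ i < 1" by (simp add: eventually_all_finite)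
    then show "\<forall>\<^sub>F x in F. norm (copula_D C (g x) / s x - copula_D C (s x *\<^sub>R v) / s x)
       \<le> (\<Sum>i\<in>UNIV. \<bar>g x $ i / s x - v $ i\<bar>)"
      using spos cube
    proof eventually_elim
      case (elim x)
      have "s x *\<^sub>R v \<in> unit_cube" using elim v by (auto simp: unit_cube_def intro: less_imp_le)
      then have "\<bar>copula_D C (g x) - copula_D C (s x *\<^sub>R v)\<bar> / s x
        \<le> (\<Sum>i\<in>UNIV. \<bar>g x $ i - (s x *\<^sub>R v) $ i\<bar>) / s x"
        using elim by (intro divide_right_mono copula_D_lipschitz C) auto
      also have "\<dots> = (\<Sum>i\<in>UNIV. \<bar>g x $ i / s x - v $ i\<bar>)"
        unfolding sum_divide_distrib
      proof (rule sum.cong)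
        fix i
        have "g x $ i / s x - v $ i = (g x $ i - (s x *\<^sub>R v) $ i) / s x"
          using elim by (simp add: field_simps)
        then show "\<bar>g x $ i - (s x *\<^sub>R v) $ i\<bar> / s x = \<bar>g x $ i / s x - v $ i\<bar>"
          using elim by simp
      qed simp
      finally show ?case using elim by (simp add: diff_divide_distrib[symmetric])
    qed
  qed
  from tendsto_add[OF this filterlim_compose[OF l[OF v] s]] show ?thesis by simp
qed

lemma one_minus_powr_tendsto:
  fixes d :: "real \<Rightarrow> real"
  assumes d: "((\<lambda>t. d t * t) \<longlongrightarrow> L) at_top" and nn: "\<forall>\<^sub>F t in at_top. 0 \<le> d t"
  shows "((\<lambda>t. (1 - d t) powr t) \<longlongrightarrow> exp (- L)) at_top"
proof -
  have "((\<lambda>t. d t * t * (1 / t)) \<longlongrightarrow> L * 0) at_top"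
    by (intro tendsto_mult d) real_asymp
  moreover have "\<forall>\<^sub>F t in at_top. d t * t * (1 / t) = d t"
    using eventually_gt_at_top[of 0] by eventually_elim simp
  ultimately have "(d \<longlongrightarrow> L * 0) at_top" by (rule Lim_transform_eventually)
  then have d0: "(d \<longlongrightarrow> 0) at_top" by simp
  have lt: "\<forall>\<^sub>F t in at_top. d t < 1" using order_tendstoD(2)[OF d0] by simp
  have "((\<lambda>t. t * ln (1 - d t)) \<longlongrightarrow> - L) at_top"
  proof (rule tendsto_sandwich)
    have "((\<lambda>t. - (d t * t / (1 - d t))) \<longlongrightarrow> - (L / (1 - 0))) at_top"
      by (intro tendsto_minus tendsto_divide tendsto_diff d d0 tendsto_const) simp
    then show "((\<lambda>t. - (d t * t / (1 - d t))) \<longlongrightarrow> - L) at_top" by simp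
    show "((\<lambda>t. - (d t * t)) \<longlongrightarrow> - L) at_top" by (intro tendsto_minus d)
    show "\<forall>\<^sub>F t in at_top. t * ln (1 - d t) \<le> - (d t * t)"
      using lt eventually_gt_at_top[of 0]
    proof eventually_elim
      case (elim t)
      then have "ln (1 - d t) \<le> - d t" using ln_le_minus_one[of "1 - d t"] by simp
      then show ?case using elim mult_left_mono[of "ln (1 - d t)" "- d t" t] by (simp add: mult.commute)
    qed
    show "\<forall>\<^sub>F t in at_top. - (d t * t / (1 - d t)) \<le> t * ln (1 - d t)"
      using lt eventually_gt_at_top[of 0]
    proof eventually_elim
      case (elim t)
      have "ln (1 / (1 - d t)) \<le> 1 / (1 - d t) - 1" using elim by (intro ln_le_minus_one) simp
      moreover have "1 / (1 - d t) - 1 = d t / (1 - d t)" using elim by (simp add: field_simps)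
      ultimately have "- (d t / (1 - d t)) \<le> ln (1 - d t)" using elim by (simp add: ln_div)
      then show ?case using elim mult_left_mono[of "- (d t / (1 - d t))" "ln (1 - d t)" t]
        by (simp add: mult.commute)
    qed
  qed
  then have "((\<lambda>t. exp (t * ln (1 - d t))) \<longlongrightarrow> exp (- L)) at_top" by (rule tendsto_exp)
  moreover have "\<forall>\<^sub>F t in at_top. exp (t * ln (1 - d t)) = (1 - d t) powr t"
    using lt by eventually_elim (simp add: powr_def)
  ultimately show ?thesis by (rule Lim_transform_eventually)
qed

text \<open>
  The limiting copula is \<open>exp (- l v)\<close> at the point with coordinates \<open>exp (- v $ i)\<close>, because
  \<open>1 - exp (- v $ i / t)\<close> is asymptotic to \<open>v $ i / t\<close>.
\<close>
lemma limiting_copula_eq_exp: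
  fixes C :: "real ^ 'n \<Rightarrow> real"
  assumes C: "is_copula C"
    and l: "\<And>v. (\<And>i. 0 \<le> v $ i) \<Longrightarrow> ((\<lambda>s. copula_D C (s *\<^sub>R v) / s) \<longlongrightarrow> l v) (at_right 0)"
    and lim: "limiting_copula C C'" and v: "\<And>i. 0 \<le> v $ i"
  shows "C' (\<chi> i. exp (- v $ i)) = exp (- l v)"
proof -
  define g where "g t = (\<chi> i. 1 - exp (- v $ i / t))" for t :: real
  have cube: "\<forall>\<^sub>F t in at_top. g t \<in> unit_cube"
    using eventually_gt_at_top[of 0]
    by eventually_elim (use v in \<open>auto simp: g_def unit_cube_def\<close>)
  have "((\<lambda>t. copula_D C (g t) / (1 / t)) \<longlongrightarrow> l v) at_top"
  proof (rule copula_D_tendsto[OF C l _ _ cube v])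
    show "filterlim (\<lambda>t::real. 1 / t) (at_right 0) at_top" by real_asymp
    have "((\<lambda>t. (1 - exp (- a / t)) / (1 / t)) \<longlongrightarrow> a) at_top" for a :: real by real_asymp
    then show "((\<lambda>t. g t $ i / (1 / t)) \<longlongrightarrow> v $ i) at_top" for i by (simp add: g_def)
  qed
  then have "((\<lambda>t. copula_D C (g t) * t) \<longlongrightarrow> l v) at_top" by simp
  moreover have "\<forall>\<^sub>F t in at_top. 0 \<le> copula_D C (g t)"
    using cube
  proof eventually_elim
    case (elim t)
    then show ?case using copula_D_ge_coord[OF C elim, of undefined]
      by (simp add: unit_cube_def) (metis order_trans)
  qed
  ultimately have "((\<lambda>t. (1 - copula_D C (g t)) powr t) \<longlongrightarrow> exp (- l v)) at_top"
    by (rule one_minus_powr_tendsto)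
  moreover have "1 - copula_D C (g t) = C (\<chi> i. (\<chi> i. exp (- v $ i)) $ i powr (1 / t))" for t
    by (simp add: copula_D_def g_def powr_def)
  ultimately have 1: "((\<lambda>t. C (\<chi> i. (\<chi> i. exp (- v $ i)) $ i powr (1 / t)) powr t) \<longlongrightarrow> exp (- l v)) at_top"
    by simp
  have "(\<chi> i. exp (- v $ i)) \<in> unit_cube" using v by (simp add: unit_cube_def)
  then have "((\<lambda>t. C (\<chi> i. (\<chi> i. exp (- v $ i)) $ i powr (1 / t)) powr t) \<longlongrightarrow> C' (\<chi> i. exp (- v $ i))) at_top"
    using lim unfolding limiting_copula_def by blast
  then show ?thesis using tendsto_unique[OF trivial_limit_at_top_linorder _ 1] by blast
qed

lemma cdf_distr_eq:
  assumes "X \<in> borel_measurable M"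
  shows "cdf (distr M borel X) x = measure M {\<omega>\<in>space M. X \<omega> \<le> x}"
  using assms unfolding cdf_def
  by (subst measure_distr) (auto simp: vimage_def intro!: arg_cong[where f="measure M"])

text \<open>
  With continuous margins the copula is determined on the whole cube, since every value in \<open>{0..1}\<close>
  is attained by each marginal distribution function.
\<close>
lemma copula_of_unique:
  fixes X :: "'n::finite \<Rightarrow> 'a \<Rightarrow> real"
  assumes "prob_space M" and X[measurable]: "\<And>i. X i \<in> borel_measurable M"
    and X01: "\<And>i \<omega>. \<omega> \<in> space M \<Longrightarrow> 0 \<le> X i \<omega> \<and> X i \<omega> \<le> 1"
    and cont: "\<And>i. continuous_on UNIV (cdf (distr M borel (X i)))"
    and "copula_of M X C" and "copula_of M X C'" and u: "u \<in> unit_cube"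
  shows "C u = C' u"
proof -
  interpret prob_space M by fact
  have "\<exists>x. cdf (distr M borel (X i)) x = u $ i" for i
  proof -
    have "{\<omega>\<in>space M. X i \<omega> \<le> -1} = {}" using X01[of _ i] by force
    then have "cdf (distr M borel (X i)) (-1) = 0" by (simp only: cdf_distr_eq[OF X] measure_empty)
    moreover have "{\<omega>\<in>space M. X i \<omega> \<le> 1} = space M" using X01 by auto
    then have "cdf (distr M borel (X i)) 1 = 1" by (simp only: cdf_distr_eq[OF X] prob_space)
    ultimately show ?thesis
      using IVT'[of "cdf (distr M borel (X i))" "-1" "u $ i" 1] u continuous_on_subset[OF cont subset_UNIV, of "{-1..1}" i]
      unfolding unit_cube_def by fastforce
  qed
  then obtain x where x: "\<And>i. cdf (distr M borel (X i)) (x i) = u $ i" by metis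
  then have "(\<chi> i. cdf (distr M borel (X i)) ((\<chi> i. x i) $ i)) = u" by (simp add: vec_eq_iff)
  moreover have "C (\<chi> i. cdf (distr M borel (X i)) ((\<chi> i. x i) $ i))
    = C' (\<chi> i. cdf (distr M borel (X i)) ((\<chi> i. x i) $ i))"
    using assms(5,6) unfolding copula_of_def by metis
  ultimately show ?thesis by simp
qed

section \<open>Quantiles and tails of distribution functions\<close>

lemma is_cdf_facts:
  assumes "is_cdf F"
  shows "mono F" and "(F \<longlongrightarrow> 1) at_top" and "(F \<longlongrightarrow> 0) at_bot"
    and "0 \<le> F x" and "F x \<le> 1"
proof -
  obtain N where N: "real_distribution N" "F = cdf N" using assms unfolding is_cdf_def by blast
  interpret real_distribution N by fact
  show "mono F" unfolding N(2) by (rule monoI) (rule cdf_nondecreasing)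
  show "(F \<longlongrightarrow> 1) at_top" "(F \<longlongrightarrow> 0) at_bot" "0 \<le> F x" "F x \<le> 1"
    unfolding N(2) by (rule cdf_lim_at_top_prob cdf_lim_at_bot cdf_nonneg cdf_bounded_prob)+
qed

lemma quantile_le_iff:
  assumes "is_cdf F" and t: "0 < t" "t < 1"
  shows "quantile F t \<le> x \<longleftrightarrow> t \<le> F x"
proof -
  obtain N where N: "real_distribution N" "F = cdf N" using assms unfolding is_cdf_def by blast
  interpret cdf_distribution N unfolding cdf_distribution_def by fact
  show ?thesis using pseudoinverse[OF t, of x] t unfolding N(2) quantile_def by simp
qed

text \<open>
  The sublevel sets are read off from \<open>quantile_le_iff\<close> where \<open>0 < T \<omega> < 1\<close>; on each of the events \<open>T \<omega> = 0\<close>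
  and \<open>T \<omega> = 1\<close> the composition is constant.
\<close>
lemma measurable_quantile:
  assumes F: "is_cdf F" and [measurable]: "T \<in> borel_measurable M"
    and T: "\<And>\<omega>. \<omega> \<in> space M \<Longrightarrow> 0 \<le> T \<omega> \<and> T \<omega> \<le> 1"
  shows "(\<lambda>\<omega>. quantile F (T \<omega>)) \<in> borel_measurable M"
  unfolding borel_measurable_iff_le
proof
  fix a
  have "{\<omega>\<in>space M. quantile F (T \<omega>) \<le> a} =
     {\<omega>\<in>space M. (0 < T \<omega> \<and> T \<omega> < 1 \<and> T \<omega> \<le> F a) \<or> (T \<omega> = 0 \<and> quantile F 0 \<le> a) \<or> (T \<omega> = 1 \<and> quantile F 1 \<le> a)}"
    (is "?A = ?B")
  proof (rule Collect_cong, rule conj_cong[OF refl])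
    fix \<omega> assume "\<omega> \<in> space M"
    then consider "T \<omega> = 0" | "T \<omega> = 1" | "0 < T \<omega>" "T \<omega> < 1" using T[of \<omega>] by fastforce
    then show "quantile F (T \<omega>) \<le> a
      \<longleftrightarrow> (0 < T \<omega> \<and> T \<omega> < 1 \<and> T \<omega> \<le> F a) \<or> (T \<omega> = 0 \<and> quantile F 0 \<le> a) \<or> (T \<omega> = 1 \<and> quantile F 1 \<le> a)"
      by cases (simp_all add: quantile_le_iff[OF F])
  qed
  also have "\<dots> \<in> sets M" by measurable
  finally show "?A \<in> sets M" .
qed

lemma RV_tail_pos:
  assumes "F \<in> RV 1"
  shows "tail F x > 0"
proof (rule ccontr)
  have F: "is_cdf F" and lim: "((\<lambda>x. tail F (x * 1) / tail F x) \<longlongrightarrow> 1 powr - 1) at_top"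
    using assms zero_less_one unfolding RV_def by blast+
  assume "\<not> tail F x > 0"
  then have "F x = 1" using is_cdf_facts(5)[OF F, of x] by (simp add: tail_def)
  have "\<forall>\<^sub>F z in at_top. tail F (z * 1) / tail F z = 0"
    using eventually_ge_at_top[of x]
  proof eventually_elim
    case (elim z)
    have "F z = 1" using monoD[OF is_cdf_facts(1)[OF F] elim] \<open>F x = 1\<close> is_cdf_facts(5)[OF F, of z] by simp
    then show ?case by (simp add: tail_def)
  qed
  then have "((\<lambda>x. tail F (x * 1) / tail F x) \<longlongrightarrow> 0) at_top" by (rule tendsto_eventually)
  from tendsto_unique[OF _ this lim] show False by simp
qed

lemma RV_tail_ratio:
  assumes "F \<in> RV 1" and "y > 0"
  shows "((\<lambda>x. tail F (x * y) / tail F x) \<longlongrightarrow> 1 / y) at_top"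
  using assms unfolding RV_def by (auto simp: powr_minus_divide)

lemma tail_antimono: "is_cdf F \<Longrightarrow> x \<le> y \<Longrightarrow> tail F y \<le> tail F x"
  using is_cdf_facts(1) by (auto simp: tail_def mono_def)

lemma tail_tendsto_0:
  assumes "is_cdf F" shows "(tail F \<longlongrightarrow> 0) at_top"
  using tendsto_diff[OF tendsto_const is_cdf_facts(2)[OF assms], of 1] unfolding tail_def by simp

lemma tail_le_iff:
  assumes "is_cdf F" and "0 < t" "t < 1"
  shows "tail F x \<le> t \<longleftrightarrow> quantile F (1 - t) \<le> x"
  using quantile_le_iff[OF assms(1), of "1 - t" x] assms(2,3) by (auto simp: tail_def)

lemma quantile_tendsto_at_top:
  assumes "F \<in> RV 1"
  shows "filterlim (\<lambda>t. quantile F (1 - t)) at_top (at_right 0)"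
  unfolding filterlim_at_top
proof
  fix Z
  have F: "is_cdf F" using assms by (simp add: RV_def)
  have "\<forall>\<^sub>F t in at_right 0. t \<in> {0<..<min 1 (tail F Z)}"
    using RV_tail_pos[OF assms, of Z] by (intro eventually_at_right_real) simp
  then show "\<forall>\<^sub>F t in at_right 0. Z \<le> quantile F (1 - t)"
  proof eventually_elim
    case (elim t)
    then have "\<not> tail F Z \<le> t" by simp
    then show ?case using tail_le_iff[OF F, of t Z] elim by simp
  qed
qed

lemma cdf_zero_below_support:
  assumes F: "is_cdf F" and supp: "cdf_support F = {c..}" and x: "x < c"
  shows "F x = 0"
proof -
  \<comment> \<open>Off its support \<open>F\<close> is locally constant, hence constant on the connected set \<open>{..<c}\<close>.\<close>
  have der: "(F has_real_derivative 0) (at y)" if "y < c" for y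
  proof -
    have "y \<notin> cdf_support F" using supp that by simp
    then obtain e where e: "e > 0" "\<not> F (y - e) < F (y + e)" unfolding cdf_support_def by auto
    have const: "F z = F y" if "z \<in> ball y e" for z
    proof -
      have "F (y - e) \<le> F z" "F z \<le> F (y + e)" "F (y - e) \<le> F y" "F y \<le> F (y + e)"
        using that e(1) by (auto simp: dist_real_def intro!: monoD[OF is_cdf_facts(1)[OF F]])
      then show ?thesis using e(2) by linarith
    qed
    have "((\<lambda>_. F y) has_real_derivative 0) (at y)" by simp
    then show ?thesis
    proof (rule has_field_derivative_transform_within_open)
      show "open (ball y e)" "y \<in> ball y e" using e(1) by simp_all
      show "F y = F z" if "z \<in> ball y e" for z by (rule const[OF that, symmetric])
    qed
  qed
  have "F z = F x" if "z < x" for z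
  proof (rule DERIV_isconst_end[of z x F, symmetric])
    show "z < x" by fact
    show "continuous_on {z..x} F"
      using x by (intro continuous_at_imp_continuous_on ballI DERIV_isCont[OF der]) auto
    show "DERIV F y :> 0" if "z < y" "y < x" for y using der that x by simp
  qed
  then have "\<forall>\<^sub>F z in at_bot. F z = F x"
    unfolding eventually_at_bot_dense by blast
  then have "(F \<longlongrightarrow> F x) at_bot" by (rule tendsto_eventually)
  from tendsto_unique[OF _ this is_cdf_facts(3)[OF F]] show ?thesis by simp
qed

lemma quantile_ge_support:
  assumes F: "is_cdf F" and supp: "cdf_support F = {c..}" and t: "0 \<le> t" "t < 1"
  shows "c \<le> quantile F t"
proof (cases "t = 0")
  case True then show ?thesis by (simp add: quantile_def supp)
next
  case False
  then have t0: "0 < t" using t by simp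
  show ?thesis
  proof (rule ccontr)
    assume "\<not> c \<le> quantile F t"
    then have "F (quantile F t) = 0" by (intro cdf_zero_below_support[OF F supp]) simp
    moreover have "t \<le> F (quantile F t)" using quantile_le_iff[OF F t0 t(2), of "quantile F t"] by simp
    ultimately show False using t0 by simp
  qed
qed

lemma cdf_le_of_quantile_ge:
  assumes F: "is_cdf F" and supp: "cdf_support F = {c..}" and cont: "continuous_on {c..} F"
    and t: "0 < t" "t < 1" and x: "c < x" and q: "x \<le> quantile F t"
  shows "F x \<le> t"
proof -
  have "continuous (at x) F"
    using continuous_on_subset[OF cont, of "{c<..}"] x
    by (simp add: continuous_on_eq_continuous_at subset_iff)
  then have lim: "(F \<longlongrightarrow> F x) (at_left x)" by (auto simp: isCont_def filterlim_at_split)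
  show ?thesis
  proof (rule tendsto_upperbound[OF lim])
    show "\<forall>\<^sub>F y in at_left x. F y \<le> t"
      using eventually_at_left_real[OF x]
    proof eventually_elim
      case (elim y)
      then have "\<not> quantile F t \<le> y" using q by simp
      then show ?case using quantile_le_iff[OF F t, of y] by simp
    qed
  qed simp
qed

lemma quantile_ge_iff:
  assumes F: "F \<in> RV_star 1" and supp: "cdf_support F = {c..}"
    and t: "0 \<le> t" "t < 1" and x: "c < x"
  shows "x \<le> quantile F t \<longleftrightarrow> F x \<le> t"
proof -
  have cF: "is_cdf F" and cont: "continuous_on {c..} F" and sm: "strict_mono_on {c..} F"
    using F supp unfolding RV_star_def RV_def by auto
  have strict: "F y < F x" if "c \<le> y" "y < x" for y
    using sm that x unfolding strict_mono_on_def by auto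
  show ?thesis
  proof (cases "t = 0")
    case True
    have "0 < F x" using strict[of c] x is_cdf_facts(4)[OF cF, of c] by simp
    then show ?thesis using True x by (simp add: quantile_def supp)
  next
    case False
    then have t0: "0 < t" using t by simp
    show ?thesis
    proof
      assume "x \<le> quantile F t"
      then show "F x \<le> t" by (rule cdf_le_of_quantile_ge[OF cF supp cont t0 t(2) x])
    next
      assume le: "F x \<le> t"
      show "x \<le> quantile F t"
      proof (rule ccontr)
        assume "\<not> x \<le> quantile F t"
        then have "F (quantile F t) < F x" using quantile_ge_support[OF cF supp t] by (intro strict) auto
        moreover have "t \<le> F (quantile F t)" using quantile_le_iff[OF cF t0 t(2), of "quantile F t"] by simp
        ultimately show False using le by simp
      qed
    qed
  qed
qed

text \<open>
  Above \<open>c\<close> the distribution function is continuous, so the quantile inverts the tail exactly; an atom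
  at \<open>c\<close> is possible.
\<close>
lemma tail_quantile_eq:
  assumes F: "F \<in> RV_star 1" and supp: "cdf_support F = {c..}"
    and t: "0 < t" "t < 1" and x: "c < quantile F (1 - t)"
  shows "tail F (quantile F (1 - t)) = t"
proof -
  have cF: "is_cdf F" using F unfolding RV_star_def RV_def by auto
  have "F (quantile F (1 - t)) \<le> 1 - t"
    using quantile_ge_iff[OF F supp _ _ x, of "1 - t"] t by simp
  moreover have "1 - t \<le> F (quantile F (1 - t))"
    using quantile_le_iff[OF cF, of "1 - t" "quantile F (1 - t)"] t by simp
  ultimately show ?thesis by (simp add: tail_def)
qed

lemma weighted_quantile_ge_iff:
  assumes F: "F \<in> RV_star 1" and supp: "cdf_support F = {c..}"
    and p: "0 < p" and w: "0 < w" and x: "c < x"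
  shows "x \<le> quantile F (max 0 (1 - p / w)) \<longleftrightarrow> p \<le> w * tail F x"
proof -
  have cF: "is_cdf F" and sm: "strict_mono_on {c..} F"
    using F supp unfolding RV_star_def RV_def by auto
  have "0 < F x" using strict_mono_onD[OF sm, of c x] x is_cdf_facts(4)[OF cF, of c] by auto
  moreover have "x \<le> quantile F (max 0 (1 - p / w)) \<longleftrightarrow> F x \<le> max 0 (1 - p / w)"
    using p w by (intro quantile_ge_iff[OF F supp _ _ x]) auto
  moreover have "F x \<le> 1 - p / w \<longleftrightarrow> p \<le> w * tail F x"
    using w by (simp add: tail_def field_simps)
  ultimately show ?thesis by (auto simp: max_def)
qed

section \<open>Regular variation at zero\<close>

text \<open>
  If \<open>h\<close> composed with a tail of index \<open>1\<close> is again regularly varying of index \<open>1\<close>, then \<open>h\<close> is regularly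
  varying at \<open>0\<close> with index \<open>1\<close>.  The tail of \<open>F\<close> may jump and so miss small values \<open>t\<close>; they are
  bracketed by its values at \<open>x * q\<close> and \<open>x / q\<close>, where \<open>x\<close> is the quantile at \<open>1 - t\<close> and \<open>q\<close> tends to \<open>1\<close>.
\<close>
lemma regular_variation_via_tail:
  assumes F: "F \<in> RV 1" and h: "mono h" "\<And>t. 0 \<le> h t"
    and A: "\<And>y. y > 0 \<Longrightarrow> ((\<lambda>x. h (tail F (x * y)) / h (tail F x)) \<longlongrightarrow> 1 / y) at_top"
  shows "t > 0 \<Longrightarrow> h t > 0"
    and "y > 0 \<Longrightarrow> ((\<lambda>t. h (t * y) / h t) \<longlongrightarrow> y) (at_right 0)"
proof -
  have cF: "is_cdf F" using F by (simp add: RV_def)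
  define T where "T = tail F"
  have Tpos: "T x > 0" for x unfolding T_def by (rule RV_tail_pos[OF F])
  have hT_pos: "h (T x) > 0" for x
  proof (rule ccontr)
    assume "\<not> h (T x) > 0"
    then have 0: "h (T x) = 0" using h(2)[of "T x"] by simp
    have "\<forall>\<^sub>F z in at_top. h (T (z * 1)) / h (T z) = 0"
      using eventually_ge_at_top[of x]
    proof eventually_elim
      case (elim z)
      have "h (T z) \<le> h (T x)" using monoD[OF h(1)] tail_antimono[OF cF elim] unfolding T_def by blast
      then have "h (T z) = 0" using 0 h(2)[of "T z"] by simp
      then show ?case by simp
    qed
    then have "((\<lambda>z. h (T (z * 1)) / h (T z)) \<longlongrightarrow> 0) at_top" by (rule tendsto_eventually)
    from tendsto_unique[OF _ this A[of 1, folded T_def]] show False by simp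
  qed
  show hpos: "h t > 0" if "t > 0" for t
  proof -
    have "\<forall>\<^sub>F x in at_top. T x < t" using order_tendstoD(2)[OF tail_tendsto_0[OF cF] that] by (simp add: T_def)
    then obtain x where "T x < t" using eventually_happens'[of "at_top::real filter"] by auto
    then show ?thesis using hT_pos[of x] monoD[OF h(1), of "T x" t] by simp
  qed
  have ratio: "((\<lambda>x. f (x * a) / f (x * b)) \<longlongrightarrow> b / a) at_top"
    if "\<And>y. y > 0 \<Longrightarrow> ((\<lambda>x. f (x * y) / f x) \<longlongrightarrow> 1 / y) at_top" "\<And>x. f x > 0" "a > 0" "b > 0"
    for f :: "real \<Rightarrow> real" and a b
  proof -
    have "((\<lambda>x. (f (x * a) / f x) / (f (x * b) / f x)) \<longlongrightarrow> (1 / a) / (1 / b)) at_top"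
      using that(3,4) by (intro tendsto_divide that(1)) auto
    moreover have "f x \<noteq> 0" for x using that(2)[of x] by simp
    ultimately show ?thesis by simp
  qed
  have T_ratio: "((\<lambda>x. T (x * a) / T (x * b)) \<longlongrightarrow> b / a) at_top" if "a > 0" "b > 0" for a b
    using ratio[of T, OF _ Tpos that] RV_tail_ratio[OF F] by (simp add: T_def)
  have A_ratio: "((\<lambda>x. h (T (x * a)) / h (T (x * b))) \<longlongrightarrow> b / a) at_top" if "a > 0" "b > 0" for a b
    using ratio[of "\<lambda>x. h (T x)", OF _ hT_pos that] A by (simp add: T_def)
  define x where "x t = quantile F (1 - t)" for t
  have x_lim: "filterlim x at_top (at_right 0)" unfolding x_def by (rule quantile_tendsto_at_top[OF F])
  note ev_x = x_lim[unfolded filterlim_iff, rule_format]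
  have t01: "\<forall>\<^sub>F t in at_right 0. t \<in> {0<..<1::real}" by (rule eventually_at_right_real) simp
  show "((\<lambda>t. h (t * y) / h t) \<longlongrightarrow> y) (at_right 0)" if y: "y > 0" for y
  proof -
    have bracket: "\<forall>\<^sub>F t in at_right 0. T (x t * q) \<le> t \<and> t < T (x t * (1 / q))" if q: "q > 1" for q
      using t01 ev_x[OF eventually_gt_at_top[of 0]]
    proof eventually_elim
      case (elim t)
      have "x t \<le> x t * q" using elim q by simp
      moreover have "\<not> x t \<le> x t * (1 / q)" using elim q by (simp add: field_simps)
      ultimately show ?case using tail_le_iff[OF cF, of t] elim unfolding T_def x_def
        by (auto simp: not_le[symmetric])
    qed
    \<comment> \<open>The ratio of tails below tends to \<open>q * y\<close>.  With \<open>q\<close> in place of \<open>q\<^sup>2\<close> the limit would be \<open>y\<close>,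
      and the inequality with \<open>y\<close> would not follow.\<close>
    have up: "\<forall>\<^sub>F t in at_right 0. h (t * y) / h t \<le> h (T (x t * (1 / (q\<^sup>2 * y)))) / h (T (x t * q))"
      if q: "q > 1" for q
    proof -
      have "((\<lambda>x. T (x * (1 / (q\<^sup>2 * y))) / T (x * (1 / q))) \<longlongrightarrow> q * y) at_top"
        using T_ratio[of "1 / (q\<^sup>2 * y)" "1 / q"] q y by (simp add: power2_eq_square)
      moreover have "y < q * y" using q y by simp
      ultimately have "\<forall>\<^sub>F x in at_top. y < T (x * (1 / (q\<^sup>2 * y))) / T (x * (1 / q))"
        by (rule order_tendstoD(1))
      from ev_x[OF this] bracket[OF q] t01 show ?thesis
      proof eventually_elim
        case (elim t)
        have "t * y \<le> T (x t * (1 / q)) * y" using elim y by simp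
        also have "\<dots> \<le> T (x t * (1 / (q\<^sup>2 * y)))"
          using elim(1) Tpos[of "x t * (1 / q)"] by (simp add: pos_less_divide_eq mult.commute)
        finally show ?case
          using elim by (intro frac_le h(2) hT_pos monoD[OF h(1)]) auto
      qed
    qed
    have lo: "\<forall>\<^sub>F t in at_right 0. h (T (x t * (q\<^sup>2 / y))) / h (T (x t * (1 / q))) \<le> h (t * y) / h t"
      if q: "q > 1" for q
    proof -
      have "((\<lambda>x. T (x * (q\<^sup>2 / y)) / T (x * q)) \<longlongrightarrow> y / q) at_top"
        using T_ratio[of "q\<^sup>2 / y" q] q y by (simp add: power2_eq_square)
      moreover have "y / q < y" using q y by (simp add: field_simps)
      ultimately have "\<forall>\<^sub>F x in at_top. T (x * (q\<^sup>2 / y)) / T (x * q) < y"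
        by (rule order_tendstoD(2))
      from ev_x[OF this] bracket[OF q] t01 show ?thesis
      proof eventually_elim
        case (elim t)
        have "T (x t * (q\<^sup>2 / y)) \<le> T (x t * q) * y"
          using elim(1) Tpos[of "x t * q"] by (simp add: pos_divide_less_eq mult.commute)
        also have "\<dots> \<le> t * y" using elim y by simp
        finally show ?case
          using elim by (intro frac_le h(2) hpos monoD[OF h(1)]) auto
      qed
    qed
    have q1: "\<forall>\<^sub>F q in at_right 1. (q::real) > 1" by (simp add: eventually_at_right_less)
    show ?thesis
    proof (rule order_tendstoI)
      fix u assume u: "y < u"
      have "((\<lambda>q::real. q ^ 3 * y) \<longlongrightarrow> 1 ^ 3 * y) (at_right 1)" by (intro tendsto_intros)
      then have "\<forall>\<^sub>F q in at_right 1. q ^ 3 * y < u" using order_tendstoD(2)[of _ "y"] u by simp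
      with q1 have "\<forall>\<^sub>F q in at_right 1. q > 1 \<and> q ^ 3 * y < u" by eventually_elim simp
      then obtain q where q: "q > 1" "q ^ 3 * y < u" using eventually_happens'[of "at_right (1::real)"] by auto
      have "((\<lambda>x. h (T (x * (1 / (q\<^sup>2 * y)))) / h (T (x * q))) \<longlongrightarrow> q ^ 3 * y) at_top"
        using A_ratio[of "1 / (q\<^sup>2 * y)" q] q(1) y by (simp add: power2_eq_square power3_eq_cube mult_ac)
      from ev_x[OF order_tendstoD(2)[OF this q(2)]] up[OF q(1)]
      show "\<forall>\<^sub>F t in at_right 0. h (t * y) / h t < u" by eventually_elim simp
    next
      fix l assume l: "l < y"
      have "((\<lambda>q::real. y / q ^ 3) \<longlongrightarrow> y / 1 ^ 3) (at_right 1)" by (intro tendsto_intros) simp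
      then have "\<forall>\<^sub>F q in at_right 1. l < y / q ^ 3" using order_tendstoD(1)[of _ "y"] l by simp
      with q1 have "\<forall>\<^sub>F q in at_right 1. q > 1 \<and> l < y / q ^ 3" by eventually_elim simp
      then obtain q where q: "q > 1" "l < y / q ^ 3" using eventually_happens'[of "at_right (1::real)"] by auto
      have "((\<lambda>x. h (T (x * (q\<^sup>2 / y))) / h (T (x * (1 / q)))) \<longlongrightarrow> y / q ^ 3) at_top"
        using A_ratio[of "q\<^sup>2 / y" "1 / q"] q(1) y by (simp add: power2_eq_square power3_eq_cube mult_ac)
      from ev_x[OF order_tendstoD(1)[OF this q(2)]] lo[OF q(1)]
      show "\<forall>\<^sub>F t in at_right 0. l < h (t * y) / h t" by eventually_elim simp
    qed
  qed
qed

text \<open>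
  By monotonicity of \<open>h\<close>, regular variation also holds along arguments that are only asymptotically
  proportional.
\<close>
lemma regular_variation_uniform:
  fixes h :: "real \<Rightarrow> real"
  assumes h: "mono h" "\<And>t. t > 0 \<Longrightarrow> h t > 0"
    and RV: "\<And>y. y > 0 \<Longrightarrow> ((\<lambda>t. h (t * y) / h t) \<longlongrightarrow> y) (at_right 0)"
    and s: "filterlim s (at_right 0) \<F>" and r: "((\<lambda>x. r x / s x) \<longlongrightarrow> \<theta>) \<F>" and \<theta>: "\<theta> > 0"
  shows "((\<lambda>x. h (r x) / h (s x)) \<longlongrightarrow> \<theta>) \<F>"
proof -
  have spos: "\<forall>\<^sub>F x in \<F>. 0 < s x" using s by (simp add: filterlim_at eventually_conj_iff)
  have lim: "((\<lambda>x. h (s x * y) / h (s x)) \<longlongrightarrow> y) \<F>" if "y > 0" for y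
    by (rule filterlim_compose[OF RV[OF that] s])
  show ?thesis
  proof (rule order_tendstoI)
    fix u assume "\<theta> < u"
    then obtain y where y: "\<theta> < y" "y < u" using dense by blast
    with \<theta> have "y > 0" by simp
    show "\<forall>\<^sub>F x in \<F>. h (r x) / h (s x) < u"
      using order_tendstoD(2)[OF lim[OF \<open>y > 0\<close>] y(2)] order_tendstoD(2)[OF r y(1)] spos
    proof eventually_elim
      case (elim x)
      then have "r x \<le> s x * y" by (simp add: pos_divide_less_eq mult.commute)
      then have "h (r x) / h (s x) \<le> h (s x * y) / h (s x)"
        using elim by (intro divide_right_mono monoD[OF h(1)]) (auto intro: less_imp_le h(2))
      then show ?case using elim by simp
    qed
  next
    fix l assume "l < \<theta>"
    with \<theta> obtain y where y: "max 0 l < y" "y < \<theta>" using dense[of "max 0 l" \<theta>] by auto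
    then have "y > 0" "l < y" by auto
    show "\<forall>\<^sub>F x in \<F>. l < h (r x) / h (s x)"
      using order_tendstoD(1)[OF lim[OF \<open>y > 0\<close>] \<open>l < y\<close>] order_tendstoD(1)[OF r y(2)] spos
    proof eventually_elim
      case (elim x)
      then have "s x * y \<le> r x" by (simp add: pos_less_divide_eq mult.commute)
      then have "h (s x * y) / h (s x) \<le> h (r x) / h (s x)"
        using elim by (intro divide_right_mono monoD[OF h(1)]) (auto intro: less_imp_le h(2))
      then show ?case using elim by simp
    qed
  qed
qed

section \<open>Relative strengths of the signals\<close>

lemma continuously_distributed_AE_neq:
  assumes "prob_space M" and X[measurable]: "X \<in> borel_measurable M" and "continuously_distributed M X"
  shows "AE \<omega> in M. X \<omega> \<noteq> c"
proof -
  interpret prob_space M by fact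
  interpret D: real_distribution "distr M borel X" by (rule real_distribution_distr) fact
  have "isCont (cdf (distr M borel X)) c"
    using assms(3) unfolding continuously_distributed_def by (simp add: continuous_on_eq_continuous_at)
  then have "measure (distr M borel X) {c} = 0" by (simp add: D.isCont_cdf)
  moreover have "measure (distr M borel X) {c} = measure M {\<omega>\<in>space M. X \<omega> = c}"
    by (subst measure_distr) (auto intro!: arg_cong[where f="measure M"])
  ultimately show ?thesis by (subst prob_Collect_eq_0[symmetric]) auto
qed

lemma prob_below_eq_cdf:
  assumes M: "prob_space M" and X[measurable]: "X \<in> borel_measurable M" and "continuously_distributed M X"
  shows "prob_below M X t = cdf (distr M borel X) t"
proof -
  interpret prob_space M by fact
  have "AE \<omega> in M. X \<omega> \<noteq> t" by (rule continuously_distributed_AE_neq) fact+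
  then have "measure M {\<omega>\<in>space M. X \<omega> < t} = measure M {\<omega>\<in>space M. X \<omega> \<le> t}"
    by (intro finite_measure_eq_AE) auto
  then show ?thesis by (simp add: prob_below_def cdf_distr_eq[OF X])
qed

lemma prob_below_mono:
  assumes "prob_space M" and [measurable]: "X \<in> borel_measurable M"
  shows "mono (prob_below M X)"
proof (rule monoI)
  interpret prob_space M by fact
  fix s t :: real assume "s \<le> t"
  then show "prob_below M X s \<le> prob_below M X t"
    unfolding prob_below_def by (intro finite_measure_mono) auto
qed

lemma prob_below_tendsto_0:
  assumes "prob_space M" and X: "X \<in> borel_measurable M" and "continuously_distributed M X"
    and "\<And>\<omega>. \<omega> \<in> space M \<Longrightarrow> 0 \<le> X \<omega>"
  shows "(prob_below M X \<longlongrightarrow> 0) (at_right 0)"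
proof -
  have "isCont (cdf (distr M borel X)) 0"
    using assms(3) unfolding continuously_distributed_def by (simp add: continuous_on_eq_continuous_at)
  moreover have "prob_below M X = cdf (distr M borel X)"
    by (rule ext) (rule prob_below_eq_cdf[OF assms(1-3)])
  ultimately have "isCont (prob_below M X) 0" by simp
  moreover have "prob_below M X 0 = 0"
  proof -
    have "{\<omega>\<in>space M. X \<omega> < 0} = {}" using assms(4) by force
    then show ?thesis unfolding prob_below_def by (simp only: measure_empty)
  qed
  ultimately show ?thesis by (simp add: isCont_def filterlim_at_split)
qed

lemma prob_below_distr:
  assumes [measurable]: "X \<in> borel_measurable M"
  shows "prob_below M X t = measure (distr M borel X) {..<t}"
  unfolding prob_below_def
  by (subst measure_distr) (auto intro!: arg_cong[where f="measure M"])

lemma dominated_irrefl: "\<not> dominated M X X"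
proof
  assume d: "dominated M X X"
  then have "\<forall>\<^sub>F t in at_right 0. prob_below M X t > 0" unfolding dominated_def by simp
  then have "\<forall>\<^sub>F t in at_right 0. prob_below M X t / prob_below M X t = 1"
    by eventually_elim simp
  then have "((\<lambda>t. prob_below M X t / prob_below M X t) \<longlongrightarrow> 1) (at_right 0)" by (rule tendsto_eventually)
  moreover have "((\<lambda>t. prob_below M X t / prob_below M X t) \<longlongrightarrow> 0) (at_right 0)"
    using d by (simp only: dominated_def)
  ultimately have "(1::real) = 0" by (intro tendsto_unique[of "at_right (0::real)"]) simp_all
  then show False by simp
qed

lemma dominated_trans:
  assumes "dominated M X Y" "dominated M Y Z"
  shows "dominated M X Z"
proof -
  have "((\<lambda>t. (prob_below M X t / prob_below M Y t) * (prob_below M Y t / prob_below M Z t))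
    \<longlongrightarrow> 0 * 0) (at_right 0)"
    using assms unfolding dominated_def by (intro tendsto_mult) auto
  moreover have "\<forall>\<^sub>F t in at_right 0. (prob_below M X t / prob_below M Y t) * (prob_below M Y t / prob_below M Z t)
      = prob_below M X t / prob_below M Z t"
    using conjunct1[OF assms(1)[unfolded dominated_def]] by eventually_elim simp
  ultimately have "((\<lambda>t. prob_below M X t / prob_below M Z t) \<longlongrightarrow> 0 * 0) (at_right 0)"
    by (rule Lim_transform_eventually)
  then show ?thesis using assms(2) unfolding dominated_def by simp
qed

text \<open>
  Domination is a strict partial order on a finite set, so every index that is not maximal lies
  below a maximal one.
\<close>
lemma dominating_signal_exists:
  fixes P :: "'n::finite \<Rightarrow> 'a \<Rightarrow> real"
  shows "i \<in> dominating_signals M P \<or> (\<exists>j\<in>dominating_signals M P. dominated M (P i) (P j))"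
proof -
  define R where "R = {(j, i). dominated M (P i) (P j)}"
  have "trans R" unfolding R_def trans_def using dominated_trans by blast
  moreover have "irrefl R" unfolding R_def irrefl_def using dominated_irrefl by auto
  ultimately have "acyclic R" by (simp add: acyclic_irrefl)
  then have "wf R" by (simp add: finite_acyclic_wf)
  then show ?thesis
  proof (induction i rule: wf_induct_rule)
    case (less i)
    show ?case
    proof (cases "i \<in> dominating_signals M P")
      case False
      then obtain j where j: "dominated M (P i) (P j)" unfolding dominating_signals_def by blast
      then have "(j, i) \<in> R" by (simp add: R_def)
      from less[OF this] j show ?thesis using dominated_trans by blast
    qed simp
  qed
qed

text \<open>
  The values \<open>0\<close> and \<open>1\<close> of \<open>X\<close>, for which \<open>quantile_le_iff\<close> says nothing, are null events.
\<close>
lemma tail_quantile_transform: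
  assumes M: "prob_space M" and X[measurable]: "X \<in> borel_measurable M" and cont: "continuously_distributed M X"
    and X01: "\<And>\<omega>. \<omega> \<in> space M \<Longrightarrow> 0 \<le> X \<omega> \<and> X \<omega> \<le> 1" and F: "is_cdf F"
  shows "tail (cdf (distr M borel (\<lambda>\<omega>. quantile F (1 - X \<omega>)))) x = prob_below M X (tail F x)"
proof -
  interpret prob_space M by fact
  have Q[measurable]: "(\<lambda>\<omega>. quantile F (1 - X \<omega>)) \<in> borel_measurable M"
    using X01 by (intro measurable_quantile F) auto
  have "AE \<omega> in M. X \<omega> \<noteq> 0" "AE \<omega> in M. X \<omega> \<noteq> 1"
    by (rule continuously_distributed_AE_neq[OF M X cont])+
  then have "AE \<omega> in M. \<omega> \<in> {\<omega>\<in>space M. \<not> quantile F (1 - X \<omega>) \<le> x} \<longleftrightarrow> \<omega> \<in> {\<omega>\<in>space M. X \<omega> < tail F x}"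
    using AE_space
  proof eventually_elim
    case (elim \<omega>)
    then have "0 < 1 - X \<omega>" "1 - X \<omega> < 1" using X01[of \<omega>] by auto
    from quantile_le_iff[OF F this, of x] show ?case by (auto simp: tail_def)
  qed
  then have "measure M {\<omega>\<in>space M. \<not> quantile F (1 - X \<omega>) \<le> x} = measure M {\<omega>\<in>space M. X \<omega> < tail F x}"
    by (intro finite_measure_eq_AE) auto
  moreover have "measure M {\<omega>\<in>space M. \<not> quantile F (1 - X \<omega>)
    \<le> x} = 1 - measure M {\<omega>\<in>space M. quantile F (1 - X \<omega>) \<le> x}"
    by (rule prob_neg) measurable
  ultimately show ?thesis by (simp add: tail_def cdf_distr_eq[OF Q] prob_below_def)
qed

text \<open>
  The dominating signal \<open>i0\<close> with regularly varying quantile transform serves as common scale;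
  dominated signals have relative strength \<open>0\<close>.
\<close>
lemma signal_strengths:
  fixes P :: "'n::finite \<Rightarrow> 'a \<Rightarrow> real"
  assumes pv: "pvalues M P" and cont: "\<And>i. continuously_distributed M (P i)"
    and comp: "comparable_signals M P" and reg: "regular_signal M P"
  obtains i0 L where "\<And>t. t > 0 \<Longrightarrow> prob_below M (P i0) t > 0"
    and "\<And>y. y > 0 \<Longrightarrow> ((\<lambda>t. prob_below M (P i0) (t * y) / prob_below M (P i0) t) \<longlongrightarrow> y) (at_right 0)"
    and "\<And>i. ((\<lambda>t. prob_below M (P i) t / prob_below M (P i0) t) \<longlongrightarrow> L i) (at_right 0)"
    and "L i0 = 1"
proof -
  have M: "prob_space M" and X[measurable]: "\<And>i. P i \<in> borel_measurable M"
    and P01: "\<And>i \<omega>. \<omega> \<in> space M \<Longrightarrow> 0 \<le> P i \<omega> \<and> P i \<omega> \<le> 1"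
    using pv unfolding pvalues_def by auto
  interpret prob_space M by (rule M)
  obtain i0 F0 where i0: "i0 \<in> dominating_signals M P" and F0: "F0 \<in> RV 1"
    and Q: "cdf (distr M borel (\<lambda>\<omega>. quantile F0 (1 - P i0 \<omega>))) \<in> RV 1"
    using reg unfolding regular_signal_def by blast
  define h where "h = prob_below M (P i0)"
  have tail_Q: "tail (cdf (distr M borel (\<lambda>\<omega>. quantile F0 (1 - P i0 \<omega>)))) x = h (tail F0 x)" for x
    unfolding h_def using F0 by (intro tail_quantile_transform M X cont P01) (auto simp: RV_def)
  have ratio: "((\<lambda>x. h (tail F0 (x * y)) / h (tail F0 x)) \<longlongrightarrow> 1 / y) at_top" if "y > 0" for y
    using RV_tail_ratio[OF Q that] unfolding tail_Q .
  have mono: "mono h" unfolding h_def by (rule prob_below_mono[OF M X])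
  have nn: "0 \<le> h t" for t unfolding h_def prob_below_def by simp
  have hpos: "h t > 0" if "t > 0" for t by (rule regular_variation_via_tail(1)[OF F0 mono nn ratio that])
  have hRV: "((\<lambda>t. h (t * y) / h t) \<longlongrightarrow> y) (at_right 0)" if "y > 0" for y
    by (rule regular_variation_via_tail(2)[OF F0 mono nn ratio that])
  have ev: "\<forall>\<^sub>F t in at_right 0. h t > 0"
    using eventually_at_right_less[of "0::real"] by eventually_elim (rule hpos)
  have self: "((\<lambda>t. h t / h t) \<longlongrightarrow> 1) (at_right 0)"
    by (rule tendsto_eventually) (use ev in eventually_elim, simp)
  have dom: "\<exists>l. ((\<lambda>t. prob_below M (P i) t / h t) \<longlongrightarrow> l) (at_right 0)" if "i \<in> dominating_signals M P" for i
  proof (cases "i = i0")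
    case True then show ?thesis using self unfolding h_def by blast
  next
    case False
    then show ?thesis using comp that i0 unfolding comparable_signals_def h_def by blast
  qed
  have "\<exists>l. ((\<lambda>t. prob_below M (P i) t / h t) \<longlongrightarrow> l) (at_right 0)" for i
  proof (cases "i \<in> dominating_signals M P")
    case True then show ?thesis by (rule dom)
  next
    case False
    then obtain j where j: "j \<in> dominating_signals M P" "dominated M (P i) (P j)"
      using dominating_signal_exists by blast
    obtain l where l: "((\<lambda>t. prob_below M (P j) t / h t) \<longlongrightarrow> l) (at_right 0)" using dom[OF j(1)] by blast
    have "((\<lambda>t. (prob_below M (P i) t / prob_below M (P j) t) * (prob_below M (P j) t / h t))
      \<longlongrightarrow> 0 * l) (at_right 0)"
      using j(2) l unfolding dominated_def by (intro tendsto_mult) auto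
    moreover have "\<forall>\<^sub>F t in at_right 0. (prob_below M (P i) t / prob_below M (P j) t) * (prob_below M (P j) t / h t)
        = prob_below M (P i) t / h t"
      using conjunct1[OF j(2)[unfolded dominated_def]] by eventually_elim simp
    ultimately have "((\<lambda>t. prob_below M (P i) t / h t) \<longlongrightarrow> 0 * l) (at_right 0)"
      by (rule Lim_transform_eventually)
    then show ?thesis by blast
  qed
  then obtain L where L: "\<And>i. ((\<lambda>t. prob_below M (P i) t / h t) \<longlongrightarrow> L i) (at_right 0)" by metis
  have "L i0 = 1" using tendsto_unique[OF _ L[of i0, folded h_def] self] by simp
  show thesis
    by (rule that[of i0 L]) (use hpos hRV L \<open>L i0 = 1\<close> in \<open>simp_all add: h_def\<close>)
qed

section \<open>Asymptotic power of both tests\<close>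

text \<open>
  Strict inequalities make this an identity: \<open>a i \<le> P i\<close> is \<open>1 - P i \<le> 1 - a i\<close>, the form of event that
  defines the copula of \<open>1 - P\<close>.
\<close>
lemma union_below_eq_copula_D:
  fixes P :: "'n::finite \<Rightarrow> 'a \<Rightarrow> real"
  assumes M: "prob_space M" and P[measurable]: "\<And>i. P i \<in> borel_measurable M"
    and C: "copula_of M (\<lambda>i \<omega>. 1 - P i \<omega>) C"
  shows "measure M {\<omega>\<in>space M. \<exists>i. P i \<omega> < a i} = copula_D C (\<chi> i. prob_below M (P i) (a i))"
proof -
  interpret prob_space M by fact
  have cdf: "cdf (distr M borel (\<lambda>\<omega>. 1 - P i \<omega>)) (1 - t) = 1 - prob_below M (P i) t" for i t
  proof -
    have "cdf (distr M borel (\<lambda>\<omega>. 1 - P i \<omega>)) (1 - t) = measure M {\<omega>\<in>space M. \<not> P i \<omega> < t}"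
      by (subst cdf_distr_eq) (auto simp: not_less)
    also have "\<dots> = 1 - measure M {\<omega>\<in>space M. P i \<omega> < t}" by (rule prob_neg) measurable
    finally show ?thesis by (simp add: prob_below_def)
  qed
  have "measure M {\<omega>\<in>space M. \<not> (\<exists>i. P i \<omega> < a i)} = 1 - measure M {\<omega>\<in>space M. \<exists>i. P i \<omega> < a i}"
    by (rule prob_neg) measurable
  moreover have "{\<omega>\<in>space M. \<not> (\<exists>i. P i \<omega> < a i)} = {\<omega>\<in>space M. \<forall>i. 1 - P i \<omega> \<le> (\<chi> i. 1 - a i) $ i}"
    by (auto simp: not_less)
  moreover have "measure M {\<omega>\<in>space M. \<forall>i. 1 - P i \<omega> \<le> (\<chi> i. 1 - a i) $ i}
      = C (\<chi> i. 1 - prob_below M (P i) (a i))"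
    using spec[OF conjunct2[OF C[unfolded copula_of_def]], of "\<chi> i. 1 - a i"]
      by (simp only: cdf vec_lambda_beta)
  ultimately show ?thesis by (simp add: copula_D_def)
qed

lemma filterlim_at_right_0_scaled:
  fixes s :: "'b \<Rightarrow> real"
  assumes s: "filterlim s (at_right 0) F" and a: "((\<lambda>x. a x / s x) \<longlongrightarrow> \<theta>) F" and "\<theta> > 0"
  shows "filterlim a (at_right 0) F"
proof -
  have spos: "\<forall>\<^sub>F x in F. 0 < s x" and s0: "(s \<longlongrightarrow> 0) F"
    using s by (simp_all add: filterlim_at eventually_conj_iff)
  have "((\<lambda>x. a x / s x * s x) \<longlongrightarrow> \<theta> * 0) F" by (intro tendsto_mult a s0)
  moreover have "\<forall>\<^sub>F x in F. a x / s x * s x = a x" using spos by eventually_elim simp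
  ultimately have "(a \<longlongrightarrow> \<theta> * 0) F" by (rule Lim_transform_eventually)
  moreover have "\<forall>\<^sub>F x in F. a x > 0"
    using order_tendstoD(1)[OF a \<open>\<theta> > 0\<close>] spos by eventually_elim (simp add: zero_less_divide_iff)
  ultimately show ?thesis by (simp add: filterlim_at eventually_conj_iff eventually_mono)
qed

text \<open>
  Continuous p-values \<open>P\<close> such that \<open>1 - P\<close> has copula \<open>C\<close> with exponent function \<open>l\<close>, the limit of \<open>copula_D\<close>
  along rays, and whose marginals are measured against a common scale \<open>h\<close> of index \<open>1\<close> at \<open>0\<close>, with
  relative strengths \<open>L i\<close>.  The scale is a parameter, so that two models with the same marginals can
  share it.
\<close>
locale signal_model =
  fixes M :: "'a measure" and P :: "'n::finite \<Rightarrow> 'a \<Rightarrow> real"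
    and C :: "real ^ 'n \<Rightarrow> real" and l :: "real ^ 'n \<Rightarrow> real"
    and h :: "real \<Rightarrow> real" and L :: "'n \<Rightarrow> real"
  assumes M: "prob_space M" and P[measurable]: "\<And>i. P i \<in> borel_measurable M"
    and P01: "\<And>i \<omega>. \<omega> \<in> space M \<Longrightarrow> 0 \<le> P i \<omega> \<and> P i \<omega> \<le> 1"
    and cont: "\<And>i. continuously_distributed M (P i)"
    and C: "copula_of M (\<lambda>i \<omega>. 1 - P i \<omega>) C"
    and l: "\<And>v. (\<And>i. 0 \<le> v $ i) \<Longrightarrow> ((\<lambda>s. copula_D C (s *\<^sub>R v) / s) \<longlongrightarrow> l v) (at_right 0)"
    and h_mono: "mono h" and h_pos: "\<And>t. t > 0 \<Longrightarrow> h t > 0" and h_0: "(h \<longlongrightarrow> 0) (at_right 0)"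
    and h_RV: "\<And>y. y > 0 \<Longrightarrow> ((\<lambda>t. h (t * y) / h t) \<longlongrightarrow> y) (at_right 0)"
    and L: "\<And>i. ((\<lambda>t. prob_below M (P i) t / h t) \<longlongrightarrow> L i) (at_right 0)"
begin

sublocale prob_space M by (rule M)

lemma AE_P_neq: "AE \<omega> in M. \<forall>i. P i \<omega> \<noteq> a i"
  by (simp add: AE_all_countable continuously_distributed_AE_neq[OF M P cont])

lemma L_nonneg: "0 \<le> L i"
proof (rule tendsto_lowerbound[OF L])
  show "\<forall>\<^sub>F t in at_right 0. 0 \<le> prob_below M (P i) t / h t"
    using eventually_at_right_less[of "0::real"]
    by eventually_elim (auto simp: prob_below_def intro!: divide_nonneg_pos h_pos)
qed simp

lemma margin_limit:
  assumes s: "filterlim s (at_right 0) F" and a: "((\<lambda>x. a x / s x) \<longlongrightarrow> \<theta>) F" and "\<theta> > 0"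
  shows "((\<lambda>x. prob_below M (P i) (a x) / h (s x)) \<longlongrightarrow> L i * \<theta>) F"
proof -
  have a0: "filterlim a (at_right 0) F" by (rule filterlim_at_right_0_scaled) fact+
  have "((\<lambda>x. prob_below M (P i) (a x) / h (a x) * (h (a x) / h (s x))) \<longlongrightarrow> L i * \<theta>) F"
    by (intro tendsto_mult filterlim_compose[OF L a0]
        regular_variation_uniform[OF h_mono h_pos h_RV s a \<open>\<theta> > 0\<close>])
  moreover have "\<forall>\<^sub>F x in F. prob_below M (P i) (a x) / h (a x) * (h (a x) / h (s x))
    = prob_below M (P i) (a x) / h (s x)"
  proof -
    have "\<forall>\<^sub>F x in F. 0 < a x" using a0 by (simp add: filterlim_at eventually_conj_iff)
    then show ?thesis
    proof eventually_elim
      case (elim x)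
      then show ?case using h_pos[of "a x"] by simp
    qed
  qed
  ultimately show ?thesis by (rule Lim_transform_eventually)
qed

text \<open>
  The common asymptotics behind both tests: \<open>s\<close> is the level and \<open>a x i\<close> is a rejection threshold
  asymptotic to \<open>\<theta> i * s x\<close>.
\<close>
lemma union_limit:
  assumes s: "filterlim s (at_right 0) F" and a: "\<And>i. ((\<lambda>x. a x i / s x) \<longlongrightarrow> \<theta> i) F"
    and \<theta>: "\<And>i. \<theta> i > 0"
  shows "((\<lambda>x. measure M {\<omega>\<in>space M. \<exists>i. P i \<omega> \<le> a x i} / h (s x)) \<longlongrightarrow> l (\<chi> i. L i * \<theta> i)) F"
proof -
  have "measure M {\<omega>\<in>space M. \<exists>i. P i \<omega> \<le> a x i} = measure M {\<omega>\<in>space M. \<exists>i. P i \<omega> < a x i}" for x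
    using AE_P_neq[of "a x"]
    by (intro finite_measure_eq_AE) (auto simp: le_less)
  then have eq: "measure M {\<omega>\<in>space M. \<exists>i. P i \<omega> \<le> a x i} = copula_D C (\<chi> i. prob_below M (P i) (a x i))" for x
    using union_below_eq_copula_D[OF M P C] by simp
  show ?thesis unfolding eq
  proof (rule copula_D_tendsto[OF _ l])
    show "is_copula C" using C by (simp add: copula_of_def)
    have spos: "\<forall>\<^sub>F x in F. 0 < s x" using s by (simp add: filterlim_at eventually_conj_iff)
    have "\<forall>\<^sub>F x in F. 0 < h (s x)" using spos by eventually_elim (rule h_pos)
    then have "\<forall>\<^sub>F x in F. h (s x) \<in> {0<..} \<and> h (s x) \<noteq> 0" by eventually_elim simp
    then show "filterlim (\<lambda>x. h (s x)) (at_right 0) F"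
      using filterlim_compose[OF h_0 s] by (simp add: filterlim_at)
    show "((\<lambda>x. (\<chi> i. prob_below M (P i) (a x i)) $ i / h (s x)) \<longlongrightarrow> (\<chi> i. L i * \<theta> i) $ i) F" for i
      using margin_limit[OF s a \<theta>] by simp
    show "\<forall>\<^sub>F x in F. (\<chi> i. prob_below M (P i) (a x i)) \<in> unit_cube"
      by (simp add: unit_cube_def prob_below_def)
    show "0 \<le> (\<chi> i. L i * \<theta> i) $ i" for i using L_nonneg[of i] \<theta>[of i] by simp
  qed
qed

lemma exponent_pos:
  assumes v: "\<And>i. 0 \<le> v $ i" and j: "0 < v $ j"
  shows "0 < l v"
proof -
  have C': "is_copula C" using C by (simp add: copula_of_def)
  have "v $ j \<le> l v"
  proof (rule tendsto_lowerbound[OF l[OF v]])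
    have "((\<lambda>s. s * v $ i) \<longlongrightarrow> 0) (at_right 0)" for i by (rule tendsto_eq_intros | simp)+
    then have "\<forall>\<^sub>F s in at_right 0. s * v $ i < 1" for i by (rule order_tendstoD(2)) simp
    then have "\<forall>\<^sub>F s in at_right 0. \<forall>i. s * v $ i < 1" by (simp add: eventually_all_finite)
    then show "\<forall>\<^sub>F s in at_right 0. v $ j \<le> copula_D C (s *\<^sub>R v) / s"
      using eventually_at_right_less[of "0::real"]
    proof eventually_elim
      case (elim s)
      have "s *\<^sub>R v \<in> unit_cube" using elim v by (auto simp: unit_cube_def intro: less_imp_le)
      from copula_D_ge_coord[OF C' this, of j] show ?case using elim
        by (simp add: pos_le_divide_eq mult.commute)
    qed
  qed simp
  then show ?thesis using j by simp
qed

lemma bonferroni_power: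
  assumes w: "\<And>i. w i > 0"
  shows "((\<lambda>\<alpha>. measure M {\<omega>\<in>space M. P_bon w (\<lambda>i. P i \<omega>) \<le> \<alpha>} / h \<alpha>)
    \<longlongrightarrow> l (\<chi> i. L i * (w i / real CARD('n)))) (at_right 0)"
proof (rule Lim_transform_eventually)
  let ?n = "real CARD('n)"
  have n: "?n > 0" by simp
  show "((\<lambda>\<alpha>. measure M {\<omega>\<in>space M. \<exists>i. P i \<omega> \<le> \<alpha> * (w i / ?n)} / h \<alpha>)
    \<longlongrightarrow> l (\<chi> i. L i * (w i / ?n))) (at_right 0)"
  proof (rule union_limit[OF filterlim_ident])
    show "((\<lambda>\<alpha>. \<alpha> * (w i / ?n) / \<alpha>) \<longlongrightarrow> w i / ?n) (at_right 0)" for i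
    proof (rule tendsto_eventually)
      show "\<forall>\<^sub>F \<alpha> in at_right 0. \<alpha> * (w i / ?n) / \<alpha> = w i / ?n"
        using eventually_at_right_less[of "0::real"] by eventually_elim simp
    qed
    show "0 < w i / ?n" for i using w n by simp
  qed
  have "\<forall>\<^sub>F \<alpha> in at_right 0. \<alpha> \<in> {0<..<1::real}" by (rule eventually_at_right_real) simp
  then show "\<forall>\<^sub>F \<alpha> in at_right 0. measure M {\<omega>\<in>space M. \<exists>i. P i \<omega> \<le> \<alpha> * (w i / ?n)} / h \<alpha>
      = measure M {\<omega>\<in>space M. P_bon w (\<lambda>i. P i \<omega>) \<le> \<alpha>} / h \<alpha>"
  proof eventually_elim
    case (elim \<alpha>)
    have "P_bon w p \<le> \<alpha> \<longleftrightarrow> (\<exists>i. p i \<le> \<alpha> * (w i / ?n))" for p :: "'n \<Rightarrow> real"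
    proof -
      have "P_bon w p \<le> \<alpha> \<longleftrightarrow> (MIN i. p i / w i) \<le> \<alpha> / ?n"
        using elim n by (simp add: P_bon_def min_le_iff_disj pos_le_divide_eq mult.commute)
      also have "\<dots> \<longleftrightarrow> (\<exists>i. p i / w i \<le> \<alpha> / ?n)" by (subst Min_le_iff) auto
      also have "\<dots> \<longleftrightarrow> (\<exists>i. p i \<le> \<alpha> * (w i / ?n))" using w by (simp add: pos_divide_le_eq mult.commute)
      finally show ?thesis .
    qed
    then show ?case by simp
  qed
qed

lemma combination_power:
  assumes w: "\<And>i. w i > 0" and F: "F \<in> RV_star 1"
  shows "((\<lambda>\<alpha>. measure M {\<omega>\<in>space M. P_comb 1 F w (\<lambda>i. P i \<omega>) \<le> \<alpha>} / h \<alpha>)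
    \<longlongrightarrow> (\<Sum>i\<in>UNIV. L i * w i) / real CARD('n)) (at_right 0)"
proof -
  let ?n = "real CARD('n)"
  have n: "?n > 0" by simp
  have F1: "F \<in> RV 1" and cF: "is_cdf F" using F unfolding RV_star_def RV_def by auto
  obtain c where supp: "cdf_support F = {c..}" using F unfolding RV_star_def by blast
  define X where "X i \<omega> = quantile F (max 0 (1 - P i \<omega> / w i))" for i \<omega>
  have X[measurable]: "X i \<in> borel_measurable M" for i
    unfolding X_def using P01 w[of i] by (intro measurable_quantile cF) (auto intro: divide_nonneg_pos)
  have pos: "AE \<omega> in M. \<forall>i. 0 < P i \<omega>"
    using AE_P_neq[of "\<lambda>_. 0"] AE_space
  proof eventually_elim
    case (elim \<omega>)
    then show ?case using P01[of \<omega>] by (simp add: less_le)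
  qed
  have lower: "AE \<omega> in M. c \<le> X i \<omega>" for i
    using pos
  proof eventually_elim
    case (elim \<omega>)
    then show ?case unfolding X_def using w[of i] by (intro quantile_ge_support[OF cF supp]) auto
  qed
  have X_ge: "AE \<omega> in M. \<forall>i. c < a i \<longrightarrow> (a i \<le> X i \<omega> \<longleftrightarrow> P i \<omega> \<le> w i * tail F (a i))" for a
    using pos by eventually_elim (simp add: X_def weighted_quantile_ge_iff[OF F supp _ w])
  define H where "H x = h (tail F x)" for x
  have T_lim: "filterlim (tail F) (at_right 0) at_top"
    using tail_tendsto_0[OF cF] RV_tail_pos[OF F1] by (simp add: filterlim_at less_imp_neq[symmetric])
  have T_ratio: "((\<lambda>x. w * tail F (x * y) / tail F x) \<longlongrightarrow> w / y) at_top" if "y > 0" for w y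
    using tendsto_mult_left[OF RV_tail_ratio[OF F1 that], of w] by simp
  have Hpos: "H x > 0" for x unfolding H_def by (intro h_pos RV_tail_pos[OF F1])
  have HRV: "((\<lambda>x. H (x * y) / H x) \<longlongrightarrow> 1 / y) at_top" if "y > 0" for y
    unfolding H_def by (rule regular_variation_uniform[OF h_mono h_pos h_RV T_lim RV_tail_ratio[OF F1 that]]) (use that in auto)
  have sum_lim: "((\<lambda>x. measure M {\<omega>\<in>space M. x \<le> (\<Sum>i\<in>UNIV. X i \<omega>)} / H x) \<longlongrightarrow> (\<Sum>i\<in>UNIV. L i * w i)) at_top"
  proof (rule sum_tail_limit[OF M X lower _ HRV])
    show "\<forall>\<^sub>F x in at_top. 0 < H x" using Hpos by simp
  next
    fix a :: "'n \<Rightarrow> real" assume a: "\<And>i. 0 < a i"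
    have "((\<lambda>x. measure M {\<omega>\<in>space M. \<exists>i. x * a i \<le> X i \<omega>} / H x) \<longlongrightarrow> l (\<chi> i. L i * (w i / a i))) at_top"
    proof (rule Lim_transform_eventually)
      show "((\<lambda>x. measure M {\<omega>\<in>space M. \<exists>i. P i \<omega> \<le> w i * tail F (x * a i)} / H x)
        \<longlongrightarrow> l (\<chi> i. L i * (w i / a i))) at_top"
        unfolding H_def by (rule union_limit[OF T_lim T_ratio[OF a]]) (use a w in simp)
      have "\<forall>\<^sub>F x in at_top. c < x * a i" for i
        using eventually_gt_at_top[of "c / a i"] by eventually_elim (use a[of i] in \<open>simp add: pos_divide_less_eq\<close>)
      then have "\<forall>\<^sub>F x in at_top. \<forall>i. c < x * a i" by (simp add: eventually_all_finite)
      then show "\<forall>\<^sub>F x in at_top. measure M {\<omega>\<in>space M. \<exists>i. P i \<omega> \<le> w i * tail F (x * a i)} / H x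
          = measure M {\<omega>\<in>space M. \<exists>i. x * a i \<le> X i \<omega>} / H x"
      proof eventually_elim
        case (elim x)
        have "AE \<omega> in M. (\<omega> \<in> {\<omega>\<in>space M. \<exists>i. P i \<omega> \<le> w i * tail F (x * a i)}) = (\<omega> \<in> {\<omega>\<in>space M. \<exists>i. x * a i
          \<le> X i \<omega>})"
          using X_ge[of "\<lambda>i. x * a i"] by eventually_elim (use elim in simp)
        then have "measure M {\<omega>\<in>space M. \<exists>i. P i \<omega> \<le> w i * tail F (x * a i)} = measure M {\<omega>\<in>space M. \<exists>i. x * a i
          \<le> X i \<omega>}"
          by (rule finite_measure_eq_AE) measurable
        then show ?case by simp
      qed
    qed
    then show "\<exists>l. ((\<lambda>x. measure M {\<omega>\<in>space M. \<exists>i. x * a i \<le> X i \<omega>} / H x) \<longlongrightarrow> l) at_top" by blast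
  next
    fix i
    show "((\<lambda>x. measure M {\<omega>\<in>space M. x \<le> X i \<omega>} / H x) \<longlongrightarrow> L i * w i) at_top"
    proof (rule Lim_transform_eventually)
      show "((\<lambda>x. prob_below M (P i) (w i * tail F x) / H x) \<longlongrightarrow> L i * w i) at_top"
        unfolding H_def using T_ratio[of 1 "w i"] by (intro margin_limit[OF T_lim] w) simp
      show "\<forall>\<^sub>F x in at_top. prob_below M (P i) (w i * tail F x) / H x = measure M {\<omega>\<in>space M. x \<le> X i \<omega>} / H x"
        using eventually_gt_at_top[of c]
      proof eventually_elim
        case (elim x)
        have "AE \<omega> in M. (\<omega> \<in> {\<omega>\<in>space M. P i \<omega> < w i * tail F x}) = (\<omega> \<in> {\<omega>\<in>space M. x \<le> X i \<omega>})"
          using X_ge[of "\<lambda>i. x"] AE_P_neq[of "\<lambda>i. w i * tail F x"]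
          by eventually_elim (use elim in \<open>simp add: less_le\<close>)
        then have "measure M {\<omega>\<in>space M. P i \<omega> < w i * tail F x} = measure M {\<omega>\<in>space M. x \<le> X i \<omega>}"
          by (rule finite_measure_eq_AE) measurable
        then show ?case by (simp add: prob_below_def)
      qed
    qed
  qed
  \<comment> \<open>The level \<open>\<alpha>\<close> corresponds to the threshold \<open>n * q \<alpha>\<close> for the sum, which costs a factor \<open>1 / n\<close>.\<close>
  define q where "q \<alpha> = quantile F (1 - \<alpha>)" for \<alpha>
  have q_lim: "filterlim q at_top (at_right 0)" unfolding q_def by (rule quantile_tendsto_at_top[OF F1])
  have nq_lim: "filterlim (\<lambda>\<alpha>. q \<alpha> * ?n) at_top (at_right 0)"
    using filterlim_tendsto_pos_mult_at_top[OF tendsto_const n q_lim] by (simp add: mult.commute)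
  have "((\<lambda>\<alpha>. measure M {\<omega>\<in>space M. q \<alpha> * ?n \<le> (\<Sum>i\<in>UNIV. X i \<omega>)} / H (q \<alpha> * ?n) * (H (q \<alpha> * ?n) / H (q \<alpha>)))
      \<longlongrightarrow> (\<Sum>i\<in>UNIV. L i * w i) * (1 / ?n)) (at_right 0)"
    by (intro tendsto_mult filterlim_compose[OF sum_lim nq_lim] filterlim_compose[OF HRV[OF n] q_lim])
  moreover have "\<forall>\<^sub>F \<alpha> in at_right 0.
      measure M {\<omega>\<in>space M. q \<alpha> * ?n \<le> (\<Sum>i\<in>UNIV. X i \<omega>)} / H (q \<alpha> * ?n) * (H (q \<alpha> * ?n) / H (q \<alpha>))
      = measure M {\<omega>\<in>space M. P_comb 1 F w (\<lambda>i. P i \<omega>) \<le> \<alpha>} / h \<alpha>"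
  proof -
    have "\<forall>\<^sub>F \<alpha> in at_right 0. \<alpha> \<in> {0<..<1::real}" by (rule eventually_at_right_real) simp
    with q_lim[unfolded filterlim_iff, rule_format, OF eventually_gt_at_top[of c]] show ?thesis
    proof eventually_elim
      case (elim \<alpha>)
      have "H (q \<alpha>) = h \<alpha>"
        unfolding H_def q_def using elim by (subst tail_quantile_eq[OF F supp]) (auto simp: q_def)
      moreover have "P_comb 1 F w (\<lambda>i. P i \<omega>) \<le> \<alpha> \<longleftrightarrow> q \<alpha> * ?n \<le> (\<Sum>i\<in>UNIV. X i \<omega>)" for \<omega>
      proof -
        have "P_comb 1 F w (\<lambda>i. P i \<omega>) \<le> \<alpha> \<longleftrightarrow> tail F (weighted_mean_quantile F w (\<lambda>i. P i \<omega>)) \<le> \<alpha>"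
          using elim n by (simp add: P_comb_def min_le_iff_disj)
        also have "\<dots> \<longleftrightarrow> q \<alpha> \<le> (\<Sum>i\<in>UNIV. X i \<omega>) / ?n"
          using elim by (subst tail_le_iff[OF cF]) (auto simp: weighted_mean_quantile_def X_def q_def)
        also have "\<dots> \<longleftrightarrow> q \<alpha> * ?n \<le> (\<Sum>i\<in>UNIV. X i \<omega>)" using n by (simp add: pos_le_divide_eq)
        finally show ?thesis .
      qed
      moreover have "H (q \<alpha> * ?n) \<noteq> 0" using Hpos[of "q \<alpha> * ?n"] by simp
      ultimately show ?case by simp
    qed
  qed
  ultimately have "((\<lambda>\<alpha>. measure M {\<omega>\<in>space M. P_comb 1 F w (\<lambda>i. P i \<omega>) \<le> \<alpha>} / h \<alpha>)
      \<longlongrightarrow> (\<Sum>i\<in>UNIV. L i * w i) * (1 / ?n)) (at_right 0)"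
    by (rule Lim_transform_eventually)
  then show ?thesis by simp
qed

lemma power_ratio_limit:
  assumes w: "\<And>i. w i > 0" and F: "F \<in> RV_star 1" and j: "L j > 0"
  shows "(power_ratio M 1 F w P \<longlongrightarrow>
     ((\<Sum>i\<in>UNIV. L i * w i) / real CARD('n)) / l (\<chi> i. L i * (w i / real CARD('n)))) (at_right 0)"
    and "0 < l (\<chi> i. L i * (w i / real CARD('n)))"
proof -
  show pos: "0 < l (\<chi> i. L i * (w i / real CARD('n)))"
    using L_nonneg w j by (intro exponent_pos[of _ j]) (auto intro!: mult_nonneg_nonneg simp: less_imp_le)
  have "((\<lambda>\<alpha>. (measure M {\<omega>\<in>space M. P_comb 1 F w (\<lambda>i. P i \<omega>) \<le> \<alpha>} / h \<alpha>) /
      (measure M {\<omega>\<in>space M. P_bon w (\<lambda>i. P i \<omega>) \<le> \<alpha>} / h \<alpha>)) \<longlongrightarrow>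
     ((\<Sum>i\<in>UNIV. L i * w i) / real CARD('n)) / l (\<chi> i. L i * (w i / real CARD('n)))) (at_right 0)"
    using pos by (intro tendsto_divide combination_power bonferroni_power w F) simp
  moreover have "\<forall>\<^sub>F \<alpha> in at_right 0. (measure M {\<omega>\<in>space M. P_comb 1 F w (\<lambda>i. P i \<omega>) \<le> \<alpha>} / h \<alpha>) /
      (measure M {\<omega>\<in>space M. P_bon w (\<lambda>i. P i \<omega>) \<le> \<alpha>} / h \<alpha>) = power_ratio M 1 F w P \<alpha>"
    using eventually_at_right_less[of "0::real"]
  proof eventually_elim
    case (elim \<alpha>)
    then show ?case using h_pos[of \<alpha>] by (simp add: power_ratio_def)
  qed
  ultimately show "(power_ratio M 1 F w P \<longlongrightarrow>
     ((\<Sum>i\<in>UNIV. L i * w i) / real CARD('n)) / l (\<chi> i. L i * (w i / real CARD('n)))) (at_right 0)"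
    by (rule Lim_transform_eventually)
qed

end

section \<open>Monotonicity in the limiting copula\<close>

text \<open>
  The copula with the MRV property and the copula to which \<open>C'\<close> belongs agree on the cube.
\<close>
lemma exponent_function_exists:
  fixes P :: "'n::finite \<Rightarrow> 'a \<Rightarrow> real"
  assumes pv: "pvalues M P" and cont: "\<And>i. continuously_distributed M (P i)"
    and MRV: "has_MRV_copula M (\<lambda>i \<omega>. 1 - P i \<omega>)" and lim: "limiting_copula_of M (\<lambda>i \<omega>. 1 - P i \<omega>) C'"
  obtains C l where "copula_of M (\<lambda>i \<omega>. 1 - P i \<omega>) C"
    and "\<And>v. (\<And>i. 0 \<le> v $ i) \<Longrightarrow> ((\<lambda>s. copula_D C (s *\<^sub>R v) / s) \<longlongrightarrow> l v) (at_right 0)"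
    and "\<And>v. (\<And>i. 0 \<le> v $ i) \<Longrightarrow> C' (\<chi> i. exp (- v $ i)) = exp (- l v)"
proof -
  have M: "prob_space M" and P[measurable]: "\<And>i. P i \<in> borel_measurable M"
    and P01: "\<And>i \<omega>. \<omega> \<in> space M \<Longrightarrow> 0 \<le> P i \<omega> \<and> P i \<omega> \<le> 1"
    using pv unfolding pvalues_def by auto
  interpret prob_space M by (rule M)
  obtain C l where C: "copula_of M (\<lambda>i \<omega>. 1 - P i \<omega>) C" "is_copula C"
    and l: "\<And>v. (\<And>i. 0 \<le> v $ i) \<Longrightarrow> ((\<lambda>s. copula_D C (s *\<^sub>R v) / s) \<longlongrightarrow> l v) (at_right 0)"
    using MRV unfolding has_MRV_copula_def MRV_copula_def by blast
  obtain D where D: "copula_of M (\<lambda>i \<omega>. 1 - P i \<omega>) D" "limiting_copula D C'"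
    using lim unfolding limiting_copula_of_def by blast
  have cont': "continuous_on UNIV (cdf (distr M borel (\<lambda>\<omega>. 1 - P i \<omega>)))" for i
  proof -
    have "cdf (distr M borel (\<lambda>\<omega>. 1 - P i \<omega>)) x = 1 - cdf (distr M borel (P i)) (1 - x)" for x
    proof -
      have "cdf (distr M borel (\<lambda>\<omega>. 1 - P i \<omega>)) x = measure M {\<omega>\<in>space M. \<not> P i \<omega> < 1 - x}"
        by (subst cdf_distr_eq) (auto simp: not_less algebra_simps)
      also have "\<dots> = 1 - measure M {\<omega>\<in>space M. P i \<omega> < 1 - x}" by (rule prob_neg) measurable
      finally show ?thesis using prob_below_eq_cdf[OF M P cont] by (simp add: prob_below_def)
    qed
    moreover have "continuous_on UNIV (\<lambda>x. 1 - cdf (distr M borel (P i)) (1 - x))"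
      by (rule continuous_on_diff[OF continuous_on_const
            continuous_on_compose2[OF cont[unfolded continuously_distributed_def, of i]
              continuous_on_op_minus]]) simp
    ultimately show ?thesis by simp
  qed
  have eq: "C u = D u" if "u \<in> unit_cube" for u
    by (rule copula_of_unique[OF M _ _ cont' C(1) D(1) that]) (use P01 in auto)
  have "limiting_copula C C'"
    unfolding limiting_copula_def
  proof (intro conjI ballI)
    show "is_copula C'" using D(2) by (simp add: limiting_copula_def)
    fix u :: "real ^ 'n" assume u: "u \<in> unit_cube"
    have "((\<lambda>t. D (\<chi> i. u $ i powr (1 / t)) powr t) \<longlongrightarrow> C' u) at_top"
      using D(2) u by (simp add: limiting_copula_def)
    moreover have "\<forall>\<^sub>F t in at_top. D (\<chi> i. u $ i powr (1 / t)) powr t = C (\<chi> i. u $ i powr (1 / t)) powr t"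
      using eventually_gt_at_top[of 0]
    proof eventually_elim
      case (elim t)
      have "(\<chi> i. u $ i powr (1 / t)) \<in> unit_cube"
        using u elim by (auto simp: unit_cube_def intro!: powr_le1)
      from eq[OF this] show ?case by simp
    qed
    ultimately show "((\<lambda>t. C (\<chi> i. u $ i powr (1 / t)) powr t) \<longlongrightarrow> C' u) at_top"
      by (rule Lim_transform_eventually)
  qed
  note lc = this
  have "C' (\<chi> i. exp (- v $ i)) = exp (- l v)" if v: "\<And>i. 0 \<le> v $ i" for v
  proof (rule limiting_copula_eq_exp[OF C(2) _ lc v])
    show "((\<lambda>s. copula_D C (s *\<^sub>R u) / s) \<longlongrightarrow> l u) (at_right 0)" if "\<And>i. 0 \<le> u $ i" for u
      by (rule l[OF that])
  qed
  note C'_eq = this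
  show thesis
  proof (rule that[OF C(1)])
    show "((\<lambda>s. copula_D C (s *\<^sub>R u) / s) \<longlongrightarrow> l u) (at_right 0)" if "\<And>i. 0 \<le> u $ i" for u
      by (rule l[OF that])
    show "C' (\<chi> i. exp (- u $ i)) = exp (- l u)" if "\<And>i. 0 \<le> u $ i" for u
      by (rule C'_eq[OF that])
  qed
qed

theorem corollary4p2:
  fixes w :: "'n::finite \<Rightarrow> real" and F :: "real \<Rightarrow> real"
    and M1 :: "'a measure" and P1 :: "'n \<Rightarrow> 'a \<Rightarrow> real" and C1 :: "real ^ 'n \<Rightarrow> real"
    and M2 :: "'b measure" and P2 :: "'n \<Rightarrow> 'b \<Rightarrow> real" and C2 :: "real ^ 'n \<Rightarrow> real"
  assumes "\<And>i. w i > 0" and "(\<Sum>i\<in>UNIV. w i) = real CARD('n)"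
    and "F \<in> RV_star 1"
    and "pvalues M1 P1" and "pvalues M2 P2"
    and "\<And>i. continuously_distributed M1 (P1 i)" and "\<And>i. continuously_distributed M2 (P2 i)"
    and "has_MRV_copula M1 (\<lambda>i \<omega>. 1 - P1 i \<omega>)" and "has_MRV_copula M2 (\<lambda>i \<omega>. 1 - P2 i \<omega>)"
    and "comparable_signals M1 P1" and "comparable_signals M2 P2"
    and "regular_signal M1 P1" and "regular_signal M2 P2"
    and "limiting_copula_of M1 (\<lambda>i \<omega>. 1 - P1 i \<omega>) C1"
    and "limiting_copula_of M2 (\<lambda>i \<omega>. 1 - P2 i \<omega>) C2"
    and "\<And>i. distr M1 borel (P1 i) = distr M2 borel (P2 i)"
    and "C1 \<preceq>pw C2"
  shows "\<exists>r1 r2. (power_ratio M1 1 F w P1 \<longlongrightarrow> r1) (at_right 0) \<and>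
                 (power_ratio M2 1 F w P2 \<longlongrightarrow> r2) (at_right 0) \<and> r1 \<le> r2"
proof -
  have M1: "prob_space M1" and P1: "\<And>i. P1 i \<in> borel_measurable M1"
    and P1_01: "\<And>i \<omega>. \<omega> \<in> space M1 \<Longrightarrow> 0 \<le> P1 i \<omega> \<and> P1 i \<omega> \<le> 1"
    using assms(4) unfolding pvalues_def by auto
  have M2: "prob_space M2" and P2: "\<And>i. P2 i \<in> borel_measurable M2"
    and P2_01: "\<And>i \<omega>. \<omega> \<in> space M2 \<Longrightarrow> 0 \<le> P2 i \<omega> \<and> P2 i \<omega> \<le> 1"
    using assms(5) unfolding pvalues_def by auto
  have same: "prob_below M1 (P1 i) = prob_below M2 (P2 i)" for i
    by (rule ext) (simp add: prob_below_distr P1 P2 assms(16))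
  obtain i0 L where h: "\<And>t. t > 0 \<Longrightarrow> prob_below M1 (P1 i0) t > 0"
    "\<And>y. y > 0 \<Longrightarrow> ((\<lambda>t. prob_below M1 (P1 i0) (t * y) / prob_below M1 (P1 i0) t) \<longlongrightarrow> y) (at_right 0)"
    "\<And>i. ((\<lambda>t. prob_below M1 (P1 i) t / prob_below M1 (P1 i0) t) \<longlongrightarrow> L i) (at_right 0)"
    and L0: "L i0 = 1"
    using signal_strengths[OF assms(4,6,10,12)] by blast
  have h0: "(prob_below M1 (P1 i0) \<longlongrightarrow> 0) (at_right 0)"
    using P1_01 by (intro prob_below_tendsto_0[OF M1 P1 assms(6)]) auto
  obtain D1 l1 where D1: "copula_of M1 (\<lambda>i \<omega>. 1 - P1 i \<omega>) D1"
    "\<And>v. (\<And>i. 0 \<le> v $ i) \<Longrightarrow> ((\<lambda>s. copula_D D1 (s *\<^sub>R v) / s) \<longlongrightarrow> l1 v) (at_right 0)"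
    and C1: "\<And>v. (\<And>i. 0 \<le> v $ i) \<Longrightarrow> C1 (\<chi> i. exp (- v $ i)) = exp (- l1 v)"
    using exponent_function_exists[OF assms(4,6,8,14)] by blast
  obtain D2 l2 where D2: "copula_of M2 (\<lambda>i \<omega>. 1 - P2 i \<omega>) D2"
    "\<And>v. (\<And>i. 0 \<le> v $ i) \<Longrightarrow> ((\<lambda>s. copula_D D2 (s *\<^sub>R v) / s) \<longlongrightarrow> l2 v) (at_right 0)"
    and C2: "\<And>v. (\<And>i. 0 \<le> v $ i) \<Longrightarrow> C2 (\<chi> i. exp (- v $ i)) = exp (- l2 v)"
    using exponent_function_exists[OF assms(5,7,9,15)] by blast
  interpret m1: signal_model M1 P1 D1 l1 "prob_below M1 (P1 i0)" L
  proof (rule signal_model.intro)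
    show "0 \<le> P1 i \<omega> \<and> P1 i \<omega> \<le> 1" if "\<omega> \<in> space M1" for i \<omega> by (rule P1_01[OF that])
    show "((\<lambda>s. copula_D D1 (s *\<^sub>R v) / s) \<longlongrightarrow> l1 v) (at_right 0)" if "\<And>i. 0 \<le> v $ i" for v
      by (rule D1(2)[OF that])
    show "((\<lambda>t. prob_below M1 (P1 i) t / prob_below M1 (P1 i0) t) \<longlongrightarrow> L i) (at_right 0)" for i
      using h(3)[of i] .
    show "mono (prob_below M1 (P1 i0))" by (rule prob_below_mono[OF M1 P1])
  qed (rule M1 P1 assms(6) D1(1) h0 h(1,2) | assumption)+
  interpret m2: signal_model M2 P2 D2 l2 "prob_below M1 (P1 i0)" L
  proof (rule signal_model.intro)
    show "0 \<le> P2 i \<omega> \<and> P2 i \<omega> \<le> 1" if "\<omega> \<in> space M2" for i \<omega> by (rule P2_01[OF that])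
    show "((\<lambda>s. copula_D D2 (s *\<^sub>R v) / s) \<longlongrightarrow> l2 v) (at_right 0)" if "\<And>i. 0 \<le> v $ i" for v
      by (rule D2(2)[OF that])
    show "((\<lambda>t. prob_below M2 (P2 i) t / prob_below M1 (P1 i0) t) \<longlongrightarrow> L i) (at_right 0)" for i
      using h(3)[of i] unfolding same[of i] .
    show "mono (prob_below M1 (P1 i0))" by (rule prob_below_mono[OF M1 P1])
  qed (rule M2 P2 assms(7) D2(1) h0 h(1,2) | assumption)+
  let ?v = "\<chi> i. L i * (w i / real CARD('n))"
  have L_pos: "L i0 > 0" using L0 by simp
  have v: "0 \<le> ?v $ i" for i using m1.L_nonneg[of i] assms(1)[of i] by simp
  have "exp (- l1 ?v) \<le> exp (- l2 ?v)"
  proof -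
    have "(\<chi> i. exp (- ?v $ i)) \<in> unit_cube" using v by (simp add: unit_cube_def)
    then have "C1 (\<chi> i. exp (- ?v $ i)) \<le> C2 (\<chi> i. exp (- ?v $ i))"
      using assms(17) unfolding pw_le_def by blast
    then show ?thesis unfolding C1[OF v] C2[OF v] .
  qed
  then have "l2 ?v \<le> l1 ?v" by simp
  moreover have "0 \<le> (\<Sum>i\<in>UNIV. L i * w i) / real CARD('n)"
    using m1.L_nonneg assms(1)
      by (intro divide_nonneg_nonneg sum_nonneg mult_nonneg_nonneg) (auto intro: less_imp_le)
  moreover have "0 < l1 ?v" "0 < l2 ?v"
    by (rule m1.power_ratio_limit(2)[of w F i0] m2.power_ratio_limit(2)[of w F i0], fact+)+
  ultimately have "((\<Sum>i\<in>UNIV. L i * w i) / real CARD('n)) / l1 ?v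
    \<le> ((\<Sum>i\<in>UNIV. L i * w i) / real CARD('n)) / l2 ?v"
    by (intro divide_left_mono mult_pos_pos)
  moreover have "(power_ratio M1 1 F w P1 \<longlongrightarrow> ((\<Sum>i\<in>UNIV. L i * w i) / real CARD('n)) / l1 ?v) (at_right 0)"
    by (rule m1.power_ratio_limit(1)) fact+
  moreover have "(power_ratio M2 1 F w P2 \<longlongrightarrow> ((\<Sum>i\<in>UNIV. L i * w i) / real CARD('n)) / l2 ?v) (at_right 0)"
    by (rule m2.power_ratio_limit(1)) fact+
  ultimately show ?thesis by blast
qed

end
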